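(* Let $(M,D)$ be a compact metric space and let $(\mathcal{F},\mu)$, $\mathcal{F}=\{f_i\}_{i\in\mathcal{I}}$, be a random dynamical system of continuous maps on $M$ such that $\mathcal{F}$ is proximal on $(M,D)$ and $(\mathcal{F},\mu)$ has the local contraction property on $(M,D)$ with local contraction rate $q\in(0,1)$. Then $(\mathcal{F},\mu)$ is synchronizing on $(M,D)$ and has a unique $\mu$-stationary Borel probability measure on $M$. Moreover, for every $x,y\in M$ and for $\mu^{\mathbb{N}}$-almost every $\mathbf{i}\in\mathcal{I}^{\mathbb{N}}$ there is $C>0$ such that $$D\big(X_n^x(\mathbf{i}),X_n^y(\mathbf{i})\big)\le C q^n\quad\text{for all } n\in\mathbb{N}.$$
   Context: Random dynamical system: $C^0(M)$ is the space of continuous maps $f\colon M\to M$ with the supremum distance $D_\infty(f,g)=\sup_{x\in M}D(f(x),g(x))$. $\mathcal{F}=\{f_i\}_{i\in\mathcal{I}}\subset C^0(M)$ is indexed by a set $\mathcal{I}$ (one may take $\mathcal{I}=\mathcal{F}$); $\mathcal{I}$ carries the $\sigma$-algebra (and topology) induced by that of $(\mathcal{F},D_\infty)$, and $\mu$ is a probability measure on $\mathcal{I}$ which is non-degenerate, i.e. the support of $\mu$ is $\mathcal{I}$. The pair $(\mathcal{F},\mu)$ is called a random dynamical system. $\mu^{\mathbb{N}}$ is the product measure on $\mathcal{I}^{\mathbb{N}}$. For $\mathbf{i}=(i_1,i_2,\ldots)\in\mathcal{I}^{\mathbb{N}}$ and $n\in\mathbb{N}$ put $f_{\mathbf{i}}^n=f_{i_n}\circ\cdots\circ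 f_{i_1}$, $X_n^x(\mathbf{i})=f_{\mathbf{i}}^n(x)$, $X_0^x(\mathbf{i})=x$. A Borel probability measure $\nu$ on $M$ is $\mu$-stationary if $\nu=\int (f_i)_*\nu\,d\mu(i)$, where $(f_i)_*\nu=\nu\circ f_i^{-1}$. Proximal: for every $x,y\in M$ there exist $\mathbf{i}\in\mathcal{I}^{\mathbb{N}}$ and a (strictly increasing) sequence $(n_k)_{k}$ with $\lim_{k\to\infty}D(f_{\mathbf{i}}^{n_k}(x),f_{\mathbf{i}}^{n_k}(y))=0$. Local contraction property with local contraction rate $q\in(0,1)$: for every $x\in M$, for $\mu^{\mathbb{N}}$-almost every $\mathbf{i}\in\mathcal{I}^{\mathbb{N}}$ there exists a neighborhood $B$ of $x$ such that $\operatorname{diam}_D(f_{\mathbf{i}}^n(B))\le q^n$ for all $n\in\mathbb{N}$. Synchronizing: for every $x,y\in M$ and $\mu^{\mathbb{N}}$-almost every $\mathbf{i}\in\mathcal{I}^{\mathbb{N}}$, $\lim_{n\to\infty}D(X_n^x(\mathbf{i}),X_n^y(\mathbf{i}))=0$. *)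

theory Defs
  imports "HOL-Probability.Probability"
begin

text \<open>
  The metric space \<open>M\<close> is the type \<open>'a\<close>; its compactness is stated as \<open>compact UNIV\<close>. The space
  \<open>C\<^sup>0(M)\<close> is then the library type \<open>'a \<Rightarrow>\<^sub>C 'a\<close> of bounded continuous maps, boundedness being
  automatic on a compact space, and its \<^const>\<open>dist\<close> is the supremum distance \<open>D\<^sub>\<infinity>\<close>.

  The index set carries the topology and the \<open>\<sigma>\<close>-algebra pulled back along \<open>i \<mapsto> f i\<close>; the
  indexing need not be injective, and \<open>f = id\<close> is the case in which the family indexes itself.
\<close>

definition index_topology :: "'i set \<Rightarrow> ('i \<Rightarrow> 'a \<Rightarrow>\<^sub>C 'a::metric_space) \<Rightarrow> 'i topology" where
  "index_topology I f = pullback_topology I f euclidean"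

definition measure_support :: "'i topology \<Rightarrow> 'i measure \<Rightarrow> 'i set" where
  "measure_support T \<mu> = {i \<in> topspace T. \<forall>U. openin T U \<and> i \<in> U \<longrightarrow> emeasure \<mu> U > 0}"

definition random_dynamical_system ::
    "'i set \<Rightarrow> ('i \<Rightarrow> 'a \<Rightarrow>\<^sub>C 'a::metric_space) \<Rightarrow> 'i measure \<Rightarrow> bool" where
  "random_dynamical_system I f \<mu> \<longleftrightarrow>
     prob_space \<mu> \<and> space \<mu> = I \<and> sets \<mu> = sets (vimage_algebra I f borel) \<and>
     measure_support (index_topology I f) \<mu> = I"

text \<open>
  Index sequences are numbered from \<open>0\<close>, so \<open>\<omega> k\<close> is the index written \<open>i\<^bsub>k+1\<^esub>\<close> in
  \<open>(i\<^sub>1, i\<^sub>2, \<dots>)\<close>. The random variable \<open>X\<^bsub>n\<^esub>\<^bsup>x\<^esup>\<close> is \<open>\<lambda>\<omega>. iterate f \<omega> n x\<close>.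
\<close>

primrec iterate :: "('i \<Rightarrow> 'a \<Rightarrow>\<^sub>C 'a::metric_space) \<Rightarrow> (nat \<Rightarrow> 'i) \<Rightarrow> nat \<Rightarrow> 'a \<Rightarrow> 'a" where
  "iterate f \<omega> 0 = id"
| "iterate f \<omega> (Suc n) = apply_bcontfun (f (\<omega> n)) \<circ> iterate f \<omega> n"

abbreviation path_measure :: "'i measure \<Rightarrow> (nat \<Rightarrow> 'i) measure" where
  "path_measure \<mu> \<equiv> (\<Pi>\<^sub>M k\<in>UNIV. \<mu>)"

definition stationary ::
    "('i \<Rightarrow> 'a \<Rightarrow>\<^sub>C 'a::metric_space) \<Rightarrow> 'i measure \<Rightarrow> 'a measure \<Rightarrow> bool" where
  "stationary f \<mu> \<nu> \<longleftrightarrow> prob_space \<nu> \<and> sets \<nu> = sets borel \<and>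
     (\<forall>A\<in>sets borel. emeasure \<nu> A = (\<integral>\<^sup>+ i. emeasure (distr \<nu> borel (apply_bcontfun (f i))) A \<partial>\<mu>))"

definition proximal :: "'i set \<Rightarrow> ('i \<Rightarrow> 'a \<Rightarrow>\<^sub>C 'a::metric_space) \<Rightarrow> bool" where
  "proximal I f \<longleftrightarrow> (\<forall>x y. \<exists>\<omega>\<in>UNIV \<rightarrow> I. \<exists>r::nat \<Rightarrow> nat. strict_mono r \<and>
     (\<lambda>k. dist (iterate f \<omega> (r k) x) (iterate f \<omega> (r k) y)) \<longlonglongrightarrow> 0)"

definition local_contraction ::
    "('i \<Rightarrow> 'a \<Rightarrow>\<^sub>C 'a::metric_space) \<Rightarrow> 'i measure \<Rightarrow> real \<Rightarrow> bool" where
  "local_contraction f \<mu> q \<longleftrightarrow> (\<forall>x. AE \<omega> in path_measure \<mu>.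
     \<exists>B. x \<in> interior B \<and> (\<forall>n\<ge>1. diameter (iterate f \<omega> n ` B) \<le> q ^ n))"

definition synchronizing :: "('i \<Rightarrow> 'a \<Rightarrow>\<^sub>C 'a::metric_space) \<Rightarrow> 'i measure \<Rightarrow> bool" where
  "synchronizing f \<mu> \<longleftrightarrow> (\<forall>x y. AE \<omega> in path_measure \<mu>.
     (\<lambda>n. dist (iterate f \<omega> n x) (iterate f \<omega> n y)) \<longlonglongrightarrow> 0)"

end

theory Submission
  imports Defs
begin

text \<open>
  Local contraction and compactness make it likely that two nearby points contract at rate \<open>q\<close>
  forever. By proximality and the full support of \<open>\<mu>\<close>, any two points are brought close to one
  another with positive probability, which compactness of \<open>M \<times> M\<close> makes uniform: some
  \<open>\<alpha> > 0\<close> bounds from below the probability that two arbitrary points eventually contract at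
  rate \<open>q\<close>. By the Markov property this bound persists after conditioning on any event in the
  first \<open>n\<close> coordinates, and a zero-one argument upgrades it to probability one.

  A compactness argument makes the synchronization uniform in the initial points, in
  probability. Hence the law of the chain forgets its initial point, so that all stationary
  measures agree, and the backward iterates are Cauchy in probability; the law of their limit
  is stationary.
\<close>

subsection \<open>Measurability on a compact state space\<close>

text \<open>\<open>F\<close> is a Caratheodory function. Its value at \<open>V\<close> is a
  pointwise limit of values at countably valued approximations of \<open>V\<close>, taken from
  finite nets; compactness stands in for second countability.\<close>

lemma borel_measurable_apply_continuous:
  fixes F :: "'s \<Rightarrow> 'a::metric_space \<Rightarrow> 'b::metric_space"
  assumes compact: "compact (UNIV :: 'a set)"
    and F[measurable]: "\<And>x. (\<lambda>\<omega>. F \<omega> x) \<in> borel_measurable N"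
    and cont: "\<And>\<omega>. \<omega> \<in> space N \<Longrightarrow> continuous_on UNIV (F \<omega>)"
    and V[measurable]: "V \<in> borel_measurable N"
  shows "(\<lambda>\<omega>. F \<omega> (V \<omega>)) \<in> borel_measurable N"
proof -
  have "\<exists>d::nat \<Rightarrow> 'a. \<forall>v. \<exists>j. dist v (d j) < 1 / real (Suc k)" for k
  proof -
    obtain T :: "'a set" where "finite T" "UNIV \<subseteq> (\<Union>x\<in>T. ball x (1 / real (Suc k)))"
      using seq_compact_imp_totally_bounded[of "UNIV :: 'a set"] compact
      by (metis compact_eq_seq_compact_metric of_nat_0_less_iff zero_less_Suc zero_less_divide_1_iff)
    moreover from \<open>finite T\<close> obtain xs where "set xs = T"
      using finite_list by blast
    ultimately have "\<exists>j. dist v (xs ! j) < 1 / real (Suc k)" for v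
      by (fastforce simp: in_set_conv_nth dist_commute)
    then show ?thesis by blast
  qed
  then obtain d :: "nat \<Rightarrow> nat \<Rightarrow> 'a" where d: "\<And>k v. \<exists>j. dist v (d k j) < 1 / real (Suc k)"
    by metis
  \<comment> \<open>Taking the least admissible index makes the choice of a net point
    measurable.\<close>
  define J where "J k \<omega> = (LEAST j. dist (V \<omega>) (d k j) < 1 / real (Suc k))" for k \<omega>
  have J: "dist (V \<omega>) (d k (J k \<omega>)) < 1 / real (Suc k)" for k \<omega>
    unfolding J_def using d by (rule LeastI_ex)
  have dist[measurable]: "(\<lambda>\<omega>. dist (V \<omega>) z) \<in> borel_measurable N" for z
    by (rule measurable_compose[OF V]) (intro borel_measurable_continuous_onI continuous_intros)
  have J_meas[measurable]: "J k \<in> measurable N (count_space UNIV)" for k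
    unfolding J_def by measurable
  show ?thesis
  proof (rule borel_measurable_LIMSEQ_metric)
    show "(\<lambda>\<omega>. F \<omega> (d k (J k \<omega>))) \<in> borel_measurable N" for k
      by (rule measurable_compose_countable[where g = "J k"]) measurable
    fix \<omega> assume "\<omega> \<in> space N"
    have "(\<lambda>k. dist (d k (J k \<omega>)) (V \<omega>)) \<longlonglongrightarrow> 0"
      by (rule Lim_null_comparison[OF always_eventually LIMSEQ_inverse_real_of_nat])
        (use J less_imp_le in \<open>fastforce simp: dist_commute inverse_eq_divide\<close>)
    then have "(\<lambda>k. d k (J k \<omega>)) \<longlonglongrightarrow> V \<omega>"
      by (rule tendsto_dist_iff[THEN iffD2])
    then show "(\<lambda>k. F \<omega> (d k (J k \<omega>))) \<longlonglongrightarrow> F \<omega> (V \<omega>)"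
      using cont[OF \<open>\<omega> \<in> space N\<close>]
      by (metis UNIV_I continuous_on_eq_continuous_at isCont_tendsto_compose open_UNIV)
  qed
qed

text \<open>With one argument frozen, \<open>dist\<close> is measurable in the other, and it is
  continuous in each; the previous lemma then bypasses the Borel sets of the product.\<close>

lemma borel_measurable_dist_compact:
  fixes U V :: "'s \<Rightarrow> 'a::metric_space"
  assumes "compact (UNIV :: 'a set)"
    and U: "U \<in> borel_measurable N" and V: "V \<in> borel_measurable N"
  shows "(\<lambda>\<omega>. dist (U \<omega>) (V \<omega>)) \<in> borel_measurable N"
proof (rule borel_measurable_apply_continuous[OF assms(1) _ _ V])
  show "(\<lambda>\<omega>. dist (U \<omega>) x) \<in> borel_measurable N" for x
    by (rule measurable_compose[OF U]) (intro borel_measurable_continuous_onI continuous_intros)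
qed (intro continuous_intros)

lemma Cauchy_if_dist_Suc_le_half_power:
  fixes s :: "nat \<Rightarrow> 'b::metric_space"
  assumes "\<And>k. k \<ge> K \<Longrightarrow> dist (s (Suc k)) (s k) \<le> (1 / 2) ^ k"
  shows "Cauchy s"
proof -
  \<comment> \<open>The exact geometric sum is kept on the right because it lets the induction on
    \<open>j\<close> close.\<close>
  have tail: "dist (s (k + j)) (s k) \<le> 2 * (1 / 2) ^ k - 2 * (1 / 2) ^ (k + j)" if "k \<ge> K" for k j
  proof (induction j)
    case (Suc j)
    have "dist (s (k + Suc j)) (s k) \<le> dist (s (Suc (k + j))) (s (k + j)) + dist (s (k + j)) (s k)"
      by (simp add: dist_triangle)
    with Suc assms[of "k + j"] that show ?case by simp
  qed simp
  show ?thesis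
    unfolding Cauchy_altdef
  proof (intro allI impI)
    fix e :: real assume "0 < e"
    then obtain M where M: "(1 / 2) ^ M < e / 2"
      using real_arch_pow_inv[of "e / 2" "1 / 2"] by auto
    have "dist (s m) (s n) < e" if "max K M \<le> m" "m < n" for m n
    proof -
      obtain j where n: "n = m + j"
        using \<open>m < n\<close> less_imp_add_positive by blast
      have "(1 / 2 :: real) ^ m \<le> (1 / 2) ^ M"
        using that by (intro power_decreasing) auto
      moreover have "0 \<le> (1 / 2 :: real) ^ (m + j)"
        by simp
      ultimately show ?thesis
        using tail[of m j] that M unfolding n by (simp only: dist_commute[of "s m"]) linarith
    qed
    then show "\<exists>M. \<forall>m\<ge>M. \<forall>n>m. dist (s m) (s n) < e"
      by blast
  qed
qed

section \<open>Splitting a random path at a fixed time\<close>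

context sequence_space
begin

lemma measurable_comb_seq_right [measurable (raw)]:
  assumes "\<omega> \<in> space S"
  shows "(\<lambda>\<omega>'. comb_seq n \<omega> \<omega>') \<in> measurable S S"
  using measurable_comb_seq'[OF measurable_const[OF assms] measurable_ident[unfolded id_def]] .

text \<open>The Markov property in integrated form: splicing the first \<open>n\<close> entries of
  one path onto an independent path reproduces the law \<open>S\<close>, and Fubini does the
  rest.\<close>

lemma emeasure_comb_seq:
  assumes [measurable]: "Measurable.pred S Q"
  shows "emeasure S {\<omega> \<in> space S. Q \<omega>} =
    (\<integral>\<^sup>+ \<omega>. emeasure S {\<omega>' \<in> space S. Q (comb_seq n \<omega> \<omega>')} \<partial>S)"
proof -
  have "emeasure S {\<omega> \<in> space S. Q \<omega>} =
      emeasure (distr (S \<Otimes>\<^sub>M S) S (\<lambda>(\<omega>, \<omega>'). comb_seq n \<omega> \<omega>')) {\<omega> \<in> space S. Q \<omega>}"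
    by (simp add: PiM_comb_seq)
  also have "\<dots> = emeasure (S \<Otimes>\<^sub>M S) {p \<in> space (S \<Otimes>\<^sub>M S). Q (comb_seq n (fst p) (snd p))}"
    by (subst emeasure_distr[OF measurable_comb_seq], measurable)
      (auto intro!: arg_cong2[where f = emeasure] simp: space_pair_measure space_PiM comb_seq_def PiE_iff)
  also have "\<dots> = (\<integral>\<^sup>+ \<omega>. emeasure S (Pair \<omega> -` {p \<in> space (S \<Otimes>\<^sub>M S). Q (comb_seq n (fst p) (snd p))}) \<partial>S)"
    by (rule P.emeasure_pair_measure_alt) measurable
  also have "\<dots> = (\<integral>\<^sup>+ \<omega>. emeasure S {\<omega>' \<in> space S. Q (comb_seq n \<omega> \<omega>')} \<partial>S)"
    by (intro nn_integral_cong arg_cong2[where f = emeasure]) (auto simp: space_pair_measure)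
  finally show ?thesis .
qed

lemma prob_comb_seq_le:
  assumes [measurable]: "Measurable.pred S Q"
    and le: "\<And>\<omega>. \<omega> \<in> space S \<Longrightarrow> measure S {\<omega>' \<in> space S. Q (comb_seq n \<omega> \<omega>')} \<le> a"
  shows "measure S {\<omega> \<in> space S. Q \<omega>} \<le> a"
proof -
  \<comment> \<open>The path space is inhabited, so \<open>a\<close> bounds some probability; the
    sign is needed to return from \<open>ennreal\<close>.\<close>
  have "0 \<le> a"
    using le[of "\<lambda>_. SOME x. x \<in> space M"] measure_nonneg
    by (meson P.not_empty equals0I order_trans le)
  have "emeasure S {\<omega> \<in> space S. Q \<omega>} \<le> (\<integral>\<^sup>+ \<omega>. ennreal a \<partial>S)"
    unfolding emeasure_comb_seq[OF assms(1), of n]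
    by (intro nn_integral_mono) (simp add: P.emeasure_eq_measure le ennreal_leI)
  then show ?thesis
    using \<open>0 \<le> a\<close> by (simp add: P.emeasure_eq_measure P.prob_space)
qed

text \<open>The third assumption encodes that \<open>P\<close> is decided by the first
  \<open>n\<close> coordinates. Given such a beginning, the conditional probability of
  \<open>Q\<close> is at least \<open>a\<close>; integrating over beginnings gives the product
  bound.\<close>

lemma prob_comb_seq_conj_ge:
  assumes [measurable]: "Measurable.pred S P" "Measurable.pred S Q"
    and P: "\<And>\<omega> \<omega>'. P (comb_seq n \<omega> \<omega>') = P \<omega>"
    and "0 \<le> a"
    and ge: "\<And>\<omega>. \<omega> \<in> space S \<Longrightarrow> P \<omega> \<Longrightarrow> a \<le> measure S {\<omega>' \<in> space S. Q (comb_seq n \<omega> \<omega>')}"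
  shows "a * measure S {\<omega> \<in> space S. P \<omega>} \<le> measure S {\<omega> \<in> space S. P \<omega> \<and> Q \<omega>}"
proof -
  have "ennreal (a * measure S {\<omega> \<in> space S. P \<omega>}) =
      (\<integral>\<^sup>+ \<omega>. ennreal a * indicator {\<omega> \<in> space S. P \<omega>} \<omega> \<partial>S)"
    using \<open>0 \<le> a\<close> by (simp add: nn_integral_cmult P.emeasure_eq_measure ennreal_mult)
  also have "\<dots> \<le> (\<integral>\<^sup>+ \<omega>. emeasure S {\<omega>' \<in> space S. P (comb_seq n \<omega> \<omega>') \<and> Q (comb_seq n \<omega> \<omega>')} \<partial>S)"
    by (intro nn_integral_mono)
      (auto simp: P P.emeasure_eq_measure ge ennreal_leI split: split_indicator)
  also have "\<dots> = emeasure S {\<omega> \<in> space S. P \<omega> \<and> Q \<omega>}"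
    by (rule emeasure_comb_seq[symmetric]) measurable
  finally show ?thesis
    by (simp add: P.emeasure_eq_measure)
qed

end

section \<open>The random system and its iterates\<close>

locale compact_random_system =
  fixes I :: "'i set"
    and f :: "'i \<Rightarrow> 'a \<Rightarrow>\<^sub>C 'a::metric_space"
    and \<mu> :: "'i measure"
  assumes compact: "compact (UNIV :: 'a set)"
    and rds: "random_dynamical_system I f \<mu>"
begin

sublocale mu: prob_space \<mu>
  using rds by (simp add: random_dynamical_system_def)

sublocale sequence_space \<mu> ..

lemma space_mu: "space \<mu> = I"
  using rds by (simp add: random_dynamical_system_def)

lemma measurable_index_map [measurable]: "f \<in> borel_measurable \<mu>"
proof -
  have "sets \<mu> = sets (vimage_algebra I f borel)"
    using rds by (simp add: random_dynamical_system_def)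
  moreover have "f \<in> borel_measurable (vimage_algebra I f borel)"
    by (rule measurable_vimage_algebra1) auto
  ultimately show ?thesis
    using measurable_cong_sets by blast
qed

text \<open>Evaluation at a fixed point is continuous for the supremum distance, so the action is
  measurable in the index and continuous in the state.\<close>

lemma borel_measurable_apply_map [measurable]:
  assumes g: "g \<in> measurable N \<mu>" and V: "V \<in> borel_measurable N"
  shows "(\<lambda>\<omega>. apply_bcontfun (f (g \<omega>)) (V \<omega>)) \<in> borel_measurable N"
proof (rule borel_measurable_apply_continuous[OF compact _ _ V])
  fix x
  have "continuous_on UNIV (\<lambda>h :: 'a \<Rightarrow>\<^sub>C 'a. apply_bcontfun h x)"
    unfolding continuous_on_iff by (meson dist_fun_lt_imp_dist_val_lt)
  then show "(\<lambda>\<omega>. apply_bcontfun (f (g \<omega>)) x) \<in> borel_measurable N"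
    using borel_measurable_continuous_onI measurable_compose[OF measurable_compose[OF g measurable_index_map]]
    by blast
qed auto

lemma borel_measurable_dist_state [measurable (raw)]:
  fixes U V :: "'s \<Rightarrow> 'a"
  assumes "U \<in> borel_measurable N" and "V \<in> borel_measurable N"
  shows "(\<lambda>\<omega>. dist (U \<omega>) (V \<omega>)) \<in> borel_measurable N"
  using borel_measurable_dist_compact[OF compact assms] .

lemma borel_measurable_iterate [measurable (raw)]:
  assumes [measurable]: "W \<in> measurable N S" "V \<in> borel_measurable N"
  shows "(\<lambda>\<omega>. iterate f (W \<omega>) n (V \<omega>)) \<in> borel_measurable N"
proof (induction n)
  case (Suc n)
  have "(\<lambda>\<omega>. W \<omega> n) \<in> measurable N \<mu>"
    by measurable
  with Suc show ?case
    by (simp add: borel_measurable_apply_map)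
qed simp

lemma continuous_on_iterate: "continuous_on UNIV (iterate f \<omega> n)"
  by (induction n) (auto intro!: continuous_on_compose2[where f = "iterate f \<omega> _"] simp: o_def id_def)

lemma iterate_add: "iterate f \<omega> (m + n) x = iterate f (\<lambda>k. \<omega> (k + m)) n (iterate f \<omega> m x)"
  by (induction n) (simp_all add: add.commute)

lemma iterate_cong: "(\<And>k. k < n \<Longrightarrow> \<omega> k = \<omega>' k) \<Longrightarrow> iterate f \<omega> n = iterate f \<omega>' n"
  by (induction n) simp_all

lemma iterate_comb_seq: "iterate f (comb_seq m \<omega> \<omega>') (m + n) x = iterate f \<omega>' n (iterate f \<omega> m x)"
  by (simp add: iterate_add comb_seq_add iterate_cong[of m "comb_seq m \<omega> \<omega>'" \<omega>] comb_seq_less)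

lemma iterate_comb_seq_less: "n \<le> m \<Longrightarrow> iterate f (comb_seq m \<omega> \<omega>') n = iterate f \<omega> n"
  by (intro iterate_cong) (simp add: comb_seq_less)

subsection \<open>Almost sure exponential synchronization\<close>

text \<open>The random neighbourhood of the hypothesis is traded for a deterministic radius at the
  cost of probability \<open>e\<close>. If no radius worked, bad pairs would converge to
  \<open>z\<close>; passing to a sequence leaves countably many events, all measurable.\<close>

lemma local_contraction_prob_ge:
  assumes contr: "local_contraction f \<mu> q" and "0 < e"
  shows "\<exists>\<rho>>0. \<forall>u v. dist z u < \<rho> \<longrightarrow> dist z v < \<rho> \<longrightarrow>
    1 - e \<le> measure S {\<omega> \<in> space S. \<forall>n\<ge>1. dist (iterate f \<omega> n u) (iterate f \<omega> n v) \<le> q ^ n}"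
proof (rule ccontr)
  let ?A = "\<lambda>u v. {\<omega> \<in> space S. \<forall>n\<ge>1. dist (iterate f \<omega> n u) (iterate f \<omega> n v) \<le> q ^ n}"
  assume contra: "\<not> ?thesis"
  define R where "R m u v \<longleftrightarrow> dist z u < inverse (real (Suc m)) \<and> dist z v < inverse (real (Suc m)) \<and>
    measure S (?A u v) < 1 - e" for m u v
  have "\<exists>u v. R m u v" for m
    using contra[unfolded not_ex, rule_format, of "inverse (real (Suc m))"]
    by (auto simp: not_le R_def)
  then obtain u v where "\<And>m. R m (u m) (v m)"
    by metis
  then have u: "\<And>m. dist z (u m) < inverse (real (Suc m))"
    and v: "\<And>m. dist z (v m) < inverse (real (Suc m))"
    and less: "\<And>m. measure S (?A (u m) (v m)) < 1 - e"
    by (simp_all only: R_def)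
  \<comment> \<open>\<open>B k\<close> grows with \<open>k\<close>, and almost every path lies in
    some \<open>B k\<close>, since its own contracting ball at \<open>z\<close> contains all late
    pairs. The probabilities thus tend to 1, against the bound \<open>1 - e\<close>.\<close>
  define B where "B k = {\<omega> \<in> space S. \<forall>m\<ge>k. \<omega> \<in> ?A (u m) (v m)}" for k
  have B_sets: "range B \<subseteq> sets S"
    unfolding B_def by auto
  have "incseq B"
    by (auto simp: B_def incseq_def)
  have "AE \<omega> in S. \<exists>k. \<omega> \<in> B k"
    using contr[unfolded local_contraction_def, rule_format, of z] AE_space
  proof eventually_elim
    case (elim \<omega>)
    then obtain C where "z \<in> interior C"
      and diam: "\<And>n. n \<ge> 1 \<Longrightarrow> diameter (iterate f \<omega> n ` C) \<le> q ^ n"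
      by blast
    then obtain r where "0 < r" "ball z r \<subseteq> C"
      by (auto simp: mem_interior)
    obtain k where k: "inverse (real (Suc k)) < r"
      using \<open>0 < r\<close> reals_Archimedean by blast
    \<comment> \<open>\<open>diameter\<close> is known to dominate distances only on bounded
      sets.\<close>
    have bounded: "bounded (iterate f \<omega> n ` C)" for n
      using compact_imp_bounded[OF compact] bounded_subset by blast
    have "\<omega> \<in> ?A (u m) (v m)" if "k \<le> m" for m
    proof -
      have "inverse (real (Suc m)) \<le> inverse (real (Suc k))"
        using that by (intro le_imp_inverse_le) auto
      then have "dist z (u m) < r" "dist z (v m) < r"
        using u[of m] v[of m] k by linarith+
      then have "u m \<in> C" "v m \<in> C"
        using \<open>ball z r \<subseteq> C\<close> by auto
      then have "dist (iterate f \<omega> n (u m)) (iterate f \<omega> n (v m)) \<le> q ^ n" if "n \<ge> 1" for n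
        using diameter_bounded_bound[OF bounded] diam[OF that] by (meson image_eqI order_trans)
      then show ?thesis
        using elim by simp
    qed
    then show ?case
      using elim by (auto simp: B_def)
  qed
  then have "measure S (\<Union>k. B k) = 1"
    using B_sets by (subst P.prob_eq_1) auto
  then have "(\<lambda>k. measure S (B k)) \<longlonglongrightarrow> 1"
    using P.finite_Lim_measure_incseq[OF B_sets \<open>incseq B\<close>] by simp
  moreover have "measure S (B k) \<le> 1 - e" for k
  proof -
    have "measure S (B k) \<le> measure S (?A (u k) (v k))"
      by (intro P.finite_measure_mono) (auto simp: B_def)
    with less[of k] show ?thesis by simp
  qed
  ultimately have "1 \<le> 1 - e"
    by (intro LIMSEQ_le_const2) auto
  with \<open>0 < e\<close> show False by simp
qed

text \<open>Continuity of the last map at the reference point absorbs the error accumulated so far,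
  and closeness in supremum distance absorbs the change of that map.\<close>

lemma iterate_perturbation:
  assumes "0 < e"
  shows "\<exists>\<delta>>0. \<forall>\<omega>' x'. dist x x' < \<delta> \<longrightarrow> (\<forall>k<n. dist (f (\<omega> k)) (f (\<omega>' k)) < \<delta>) \<longrightarrow>
    dist (iterate f \<omega> n x) (iterate f \<omega>' n x') < e"
  using assms
proof (induction n arbitrary: e)
  case 0
  then show ?case by auto
next
  case (Suc n)
  let ?p = "iterate f \<omega> n x"
  have "\<exists>c>0. \<forall>p. dist p ?p < c \<longrightarrow> dist (f (\<omega> n) p) (f (\<omega> n) ?p) < e / 2"
    using continuous_on_apply_bcontfun[of UNIV "f (\<omega> n)", unfolded continuous_on_iff,
      THEN bspec, of ?p, THEN spec, of "e / 2"] Suc.prems by simp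
  then obtain c where c: "0 < c" "\<And>p. dist p ?p < c \<Longrightarrow> dist (f (\<omega> n) p) (f (\<omega> n) ?p) < e / 2"
    by auto
  obtain \<delta> where \<delta>: "0 < \<delta>"
    "\<And>\<omega>' x'. dist x x' < \<delta> \<Longrightarrow> (\<forall>k<n. dist (f (\<omega> k)) (f (\<omega>' k)) < \<delta>) \<Longrightarrow> dist ?p (iterate f \<omega>' n x') < c"
    using Suc.IH[OF \<open>0 < c\<close>] by blast
  have "dist (iterate f \<omega> (Suc n) x) (iterate f \<omega>' (Suc n) x') < e"
    if "dist x x' < min \<delta> (e / 2)" "\<forall>k<Suc n. dist (f (\<omega> k)) (f (\<omega>' k)) < min \<delta> (e / 2)" for \<omega>' x'
  proof -
    let ?p' = "iterate f \<omega>' n x'"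
    have "dist (f (\<omega> n) ?p) (f (\<omega> n) ?p') < e / 2"
      using \<delta>(2)[of x' \<omega>'] that c(2)[of ?p'] by (simp add: dist_commute)
    moreover have "dist (f (\<omega> n) ?p') (f (\<omega>' n) ?p') < e / 2"
      using that(2) by (intro dist_fun_lt_imp_dist_val_lt) auto
    ultimately show ?thesis
      using dist_triangle[of "f (\<omega> n) ?p" "f (\<omega>' n) ?p'" "f (\<omega> n) ?p'"] by simp
  qed
  then show ?case
    using \<open>0 < \<delta>\<close> Suc.prems by (intro exI[of _ "min \<delta> (e / 2)"]) simp
qed

lemma measurable_dist_index [measurable]: "(\<lambda>i. dist g (f i)) \<in> borel_measurable \<mu>"
  by (rule measurable_compose[OF measurable_index_map])
    (intro borel_measurable_continuous_onI continuous_intros)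

lemma pred_cylinder [measurable]:
  "Measurable.pred S (\<lambda>\<omega>'. \<forall>k<n. dist (f (\<omega> k)) (f (\<omega>' k)) < \<delta>)"
proof -
  have [measurable]: "(\<lambda>\<omega>'. dist (f (\<omega> k)) (f (\<omega>' k))) \<in> borel_measurable S" for k
    by (rule measurable_compose[OF _ measurable_dist_index]) measurable
  show ?thesis by measurable
qed

text \<open>Full support enters here: the preimage of a ball under \<open>f\<close> is open in the
  pullback topology, so each single constraint has positive mass, and independence multiplies
  finitely many of them.\<close>

lemma prob_cylinder_pos:
  assumes "\<omega> \<in> UNIV \<rightarrow> I" and "0 < \<delta>"
  shows "0 < measure S {\<omega>' \<in> space S. \<forall>k<n. dist (f (\<omega> k)) (f (\<omega>' k)) < \<delta>}"
proof -
  define X where "X k = {i \<in> space \<mu>. dist (f (\<omega> k)) (f i) < \<delta>}" for k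
  have X[measurable]: "X k \<in> sets \<mu>" for k
    unfolding X_def by measurable
  have "0 < emeasure \<mu> (X k)" for k
  proof -
    have "X k = f -` ball (f (\<omega> k)) \<delta> \<inter> I"
      by (auto simp: X_def space_mu)
    then have "openin (index_topology I f) (X k)"
      unfolding index_topology_def openin_pullback_topology by auto
    moreover have "\<omega> k \<in> X k"
      using assms by (auto simp: X_def space_mu)
    moreover have "\<omega> k \<in> measure_support (index_topology I f) \<mu>"
      using assms rds by (auto simp: random_dynamical_system_def)
    ultimately show ?thesis
      by (auto simp: measure_support_def)
  qed
  then have "0 < (\<Prod>k<n. emeasure \<mu> (X k))"
    by (induction n) (auto simp: ennreal_zero_less_mult_iff)
  also have "(\<Prod>k<n. emeasure \<mu> (X k)) = emeasure S {\<omega>' \<in> space S. \<forall>k\<in>{..<n}. \<omega>' k \<in> X k}"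
    by (rule emeasure_PiM_Collect[symmetric]) auto
  also have "{\<omega>' \<in> space S. \<forall>k\<in>{..<n}. \<omega>' k \<in> X k} =
      {\<omega>' \<in> space S. \<forall>k<n. dist (f (\<omega> k)) (f (\<omega>' k)) < \<delta>}"
    by (auto simp: X_def space_PiM PiE_iff)
  finally show ?thesis
    by (simp add: P.emeasure_eq_measure)
qed

text \<open>A natural number as constant makes the event a countable union, hence
  measurable.\<close>

definition exp_close :: "real \<Rightarrow> 'a \<Rightarrow> 'a \<Rightarrow> (nat \<Rightarrow> 'i) \<Rightarrow> bool" where
  "exp_close q x y \<omega> \<longleftrightarrow> (\<exists>m::nat. \<forall>n. dist (iterate f \<omega> n x) (iterate f \<omega> n y) \<le> real m * q ^ n)"

lemma pred_exp_close [measurable]: "Measurable.pred S (exp_close q x y)"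
  unfolding exp_close_def by measurable

text \<open>Contraction after some time \<open>n\<close> suffices: the constant absorbs the finitely
  many earlier distances and the shift of the exponent by \<open>n\<close>.\<close>

lemma exp_closeI:
  assumes "0 < q" "0 \<le> c"
    and le: "\<And>j. j \<ge> 1 \<Longrightarrow> dist (iterate f \<omega> (n + j) x) (iterate f \<omega> (n + j) y) \<le> c * q ^ j"
  shows "exp_close q x y \<omega>"
proof -
  let ?d = "\<lambda>k. dist (iterate f \<omega> k x) (iterate f \<omega> k y)"
  let ?s = "\<Sum>k\<le>n. ?d k / q ^ k"
  have "0 \<le> ?s"
    using \<open>0 < q\<close> by (intro sum_nonneg) auto
  obtain m where m: "c / q ^ n + ?s \<le> real m"
    using real_arch_simple by blast
  have "?d k \<le> real m * q ^ k" for k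
  proof -
    have "?d k / q ^ k \<le> c / q ^ n + ?s"
    proof (cases "k \<le> n")
      case True
      then have "?d k / q ^ k \<le> ?s"
        using \<open>0 < q\<close> by (intro member_le_sum) auto
      then show ?thesis
        using assms(1,2) by (simp add: add_increasing)
    next
      case False
      then obtain j where "k = n + j" "j \<ge> 1"
        using less_imp_add_positive by (metis One_nat_def Suc_leI not_le)
      then have "?d k / q ^ k \<le> c / q ^ n"
        using le[of j] \<open>0 < q\<close> by (simp add: field_simps power_add)
      then show ?thesis
        using \<open>0 \<le> ?s\<close> by simp
    qed
    also note m
    finally show ?thesis
      using \<open>0 < q\<close> by (simp add: pos_divide_le_eq)
  qed
  then show ?thesis
    unfolding exp_close_def by blast
qed

text \<open>Finitely many initial steps only change the constant. This is the half of tail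
  invariance that the zero-one argument uses.\<close>

lemma exp_close_comb_seq:
  assumes "0 < q" and "exp_close q (iterate f \<omega> n x) (iterate f \<omega> n y) \<omega>'"
  shows "exp_close q x y (comb_seq n \<omega> \<omega>')"
proof -
  obtain m :: nat where "\<And>k. dist (iterate f \<omega>' k (iterate f \<omega> n x)) (iterate f \<omega>' k (iterate f \<omega> n y)) \<le> real m * q ^ k"
    using assms(2) unfolding exp_close_def by blast
  then show ?thesis
    by (intro exp_closeI[where n = n and c = "real m"] assms(1)) (simp_all add: iterate_comb_seq)
qed

text \<open>A proximal path carries \<open>x\<close> and \<open>y\<close> close to a common point
  \<open>z\<close>. Paths in a cylinder around it do the same for nearby starting points and have
  positive probability; after that, contraction has conditional probability at least 1/2.\<close>

lemma prob_exp_close_locally_pos: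
  assumes prox: "proximal I f" and contr: "local_contraction f \<mu> q" and "0 < q"
  shows "\<exists>\<delta>>0. \<exists>\<alpha>>0. \<forall>x' y'. dist x x' < \<delta> \<longrightarrow> dist y y' < \<delta> \<longrightarrow>
    \<alpha> \<le> measure S {\<omega> \<in> space S. exp_close q x' y' \<omega>}"
proof -
  obtain \<omega> r where \<omega>: "\<omega> \<in> UNIV \<rightarrow> I" and "strict_mono r"
    and lim0: "(\<lambda>k. dist (iterate f \<omega> (r k) x) (iterate f \<omega> (r k) y)) \<longlonglongrightarrow> 0"
    using prox unfolding proximal_def by metis
  \<comment> \<open>Proximality does not say where the orbits approach each other; compactness
    supplies an accumulation point, and the contraction radius is taken there.\<close>
  obtain z s where "strict_mono s" and limz: "((\<lambda>k. iterate f \<omega> (r k) x) \<circ> s) \<longlonglongrightarrow> z"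
    using compact unfolding compact_eq_seq_compact_metric seq_compact_def by (metis UNIV_I)
  obtain \<rho> where "0 < \<rho>" and \<rho>: "\<And>u v. dist z u < \<rho> \<Longrightarrow> dist z v < \<rho> \<Longrightarrow>
      1 / 2 \<le> measure S {\<omega> \<in> space S. \<forall>n\<ge>1. dist (iterate f \<omega> n u) (iterate f \<omega> n v) \<le> q ^ n}"
    using local_contraction_prob_ge[OF contr, of "1/2" z] by auto
  have "\<forall>\<^sub>F k in sequentially. dist (iterate f \<omega> (r (s k)) x) z < \<rho> / 4"
    using tendstoD[OF limz, of "\<rho> / 4"] \<open>0 < \<rho>\<close> by simp
  moreover have "\<forall>\<^sub>F k in sequentially. dist (iterate f \<omega> (r (s k)) x) (iterate f \<omega> (r (s k)) y) < \<rho> / 4"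
    using tendstoD[OF LIMSEQ_subseq_LIMSEQ[OF lim0 \<open>strict_mono s\<close>], of "\<rho> / 4"] \<open>0 < \<rho>\<close> by simp
  ultimately have "\<forall>\<^sub>F k in sequentially. dist (iterate f \<omega> (r (s k)) x) z < \<rho> / 4 \<and>
      dist (iterate f \<omega> (r (s k)) x) (iterate f \<omega> (r (s k)) y) < \<rho> / 4"
    by (rule eventually_conj)
  from eventually_happens'[OF sequentially_bot this]
  obtain k where k: "dist (iterate f \<omega> (r (s k)) x) z < \<rho> / 4"
    "dist (iterate f \<omega> (r (s k)) x) (iterate f \<omega> (r (s k)) y) < \<rho> / 4"
    by blast
  define n where "n = r (s k)"
  \<comment> \<open>Half of \<open>\<rho>\<close> is spent on the reference path; the other half is
    left for perturbing the maps and the starting points.\<close>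
  have near: "dist z (iterate f \<omega> n x) < \<rho> / 2" "dist z (iterate f \<omega> n y) < \<rho> / 2"
    using k \<open>0 < \<rho>\<close> dist_triangle[of z "iterate f \<omega> n y" "iterate f \<omega> n x"]
    by (auto simp: n_def dist_commute)
  obtain \<delta>1 where \<delta>1: "0 < \<delta>1" "\<And>\<omega>' x'. dist x x' < \<delta>1 \<Longrightarrow>
      (\<forall>k<n. dist (f (\<omega> k)) (f (\<omega>' k)) < \<delta>1) \<Longrightarrow> dist (iterate f \<omega> n x) (iterate f \<omega>' n x') < \<rho> / 2"
    using iterate_perturbation[of "\<rho> / 2" x n \<omega>] \<open>0 < \<rho>\<close> by auto
  obtain \<delta>2 where \<delta>2: "0 < \<delta>2" "\<And>\<omega>' y'. dist y y' < \<delta>2 \<Longrightarrow>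
      (\<forall>k<n. dist (f (\<omega> k)) (f (\<omega>' k)) < \<delta>2) \<Longrightarrow> dist (iterate f \<omega> n y) (iterate f \<omega>' n y') < \<rho> / 2"
    using iterate_perturbation[of "\<rho> / 2" y n \<omega>] \<open>0 < \<rho>\<close> by auto
  define \<delta> where "\<delta> = min \<delta>1 \<delta>2"
  have "0 < \<delta>"
    using \<delta>1 \<delta>2 by (simp add: \<delta>_def)
  let ?P = "\<lambda>\<omega>'. \<forall>k<n. dist (f (\<omega> k)) (f (\<omega>' k)) < \<delta>"
  \<comment> \<open>The left side is the future \<open>\<alpha>\<close>; it does not depend on
    \<open>x'\<close> and \<open>y'\<close>.\<close>
  have "1 / 2 * measure S {\<omega>' \<in> space S. ?P \<omega>'} \<le> measure S {\<omega> \<in> space S. exp_close q x' y' \<omega>}"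
    if "dist x x' < \<delta>" "dist y y' < \<delta>" for x' y'
  proof -
    have "1 / 2 * measure S {\<omega>' \<in> space S. ?P \<omega>'} \<le>
        measure S {\<omega>' \<in> space S. ?P \<omega>' \<and> exp_close q x' y' \<omega>'}"
    proof (rule prob_comb_seq_conj_ge[where n = n])
      fix \<omega>' assume [measurable]: "\<omega>' \<in> space S" and "?P \<omega>'"
      let ?u = "iterate f \<omega>' n x'" and ?v = "iterate f \<omega>' n y'"
      have "dist (iterate f \<omega> n x) ?u < \<rho> / 2" "dist (iterate f \<omega> n y) ?v < \<rho> / 2"
        using that \<open>?P \<omega>'\<close> \<delta>1(2)[of x' \<omega>'] \<delta>2(2)[of y' \<omega>'] by (simp_all add: \<delta>_def)
      then have "dist z ?u < \<rho>" "dist z ?v < \<rho>"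
        using near dist_triangle[of z ?u "iterate f \<omega> n x"] dist_triangle[of z ?v "iterate f \<omega> n y"]
        by linarith+
      then have "1 / 2 \<le> measure S {\<omega> \<in> space S. \<forall>n\<ge>1. dist (iterate f \<omega> n ?u) (iterate f \<omega> n ?v) \<le> q ^ n}"
        by (rule \<rho>)
      also have "\<dots> \<le> measure S {\<omega>'' \<in> space S. exp_close q x' y' (comb_seq n \<omega>' \<omega>'')}"
      proof (rule P.finite_measure_mono)
        show "{\<omega> \<in> space S. \<forall>n\<ge>1. dist (iterate f \<omega> n ?u) (iterate f \<omega> n ?v) \<le> q ^ n} \<subseteq>
            {\<omega>'' \<in> space S. exp_close q x' y' (comb_seq n \<omega>' \<omega>'')}"
          using exp_close_comb_seq[OF \<open>0 < q\<close> exp_closeI[where n = 0 and c = 1, OF \<open>0 < q\<close>]]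
          by (intro subsetI) simp
        show "{\<omega>'' \<in> space S. exp_close q x' y' (comb_seq n \<omega>' \<omega>'')} \<in> sets S"
          by measurable
      qed
      finally show "1 / 2 \<le> measure S {\<omega>'' \<in> space S. exp_close q x' y' (comb_seq n \<omega>' \<omega>'')}" .
    qed (auto simp: comb_seq_less)
    also have "\<dots> \<le> measure S {\<omega> \<in> space S. exp_close q x' y' \<omega>}"
      by (intro P.finite_measure_mono) auto
    finally show ?thesis .
  qed
  moreover have "0 < 1 / 2 * measure S {\<omega>' \<in> space S. ?P \<omega>'}"
    using prob_cylinder_pos[OF \<omega> \<open>0 < \<delta>\<close>] by simp
  ultimately show ?thesis
    using \<open>0 < \<delta>\<close> by blast
qed

text \<open>Pairs whose probabilities tend to 0 would accumulate at some pair \<open>l\<close>,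
  where the local lower bound forbids this.\<close>

lemma prob_exp_close_uniformly_pos:
  assumes "proximal I f" and "local_contraction f \<mu> q" and "0 < q"
  shows "\<exists>\<alpha>>0. \<forall>x y. \<alpha> \<le> measure S {\<omega> \<in> space S. exp_close q x y \<omega>}"
proof (rule ccontr)
  define p where "p z = measure S {\<omega> \<in> space S. exp_close q (fst z) (snd z) \<omega>}" for z
  assume "\<not> ?thesis"
  then have "\<not> (\<exists>\<alpha>>0. \<forall>x y. \<alpha> \<le> p (x, y))"
    by (simp add: p_def)
  then have "\<exists>z. p z < inverse (real (Suc m))" for m
    using not_le by (metis inverse_positive_iff_positive of_nat_0_less_iff zero_less_Suc)
  then obtain z where z: "\<And>m. p (z m) < inverse (real (Suc m))"
    by metis
  have "seq_compact (UNIV :: ('a \<times> 'a) set)"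
    using compact_Times[OF compact compact] by (simp add: compact_eq_seq_compact_metric)
  then obtain l r where "strict_mono r" and lim: "(z \<circ> r) \<longlonglongrightarrow> l"
    unfolding seq_compact_def by (metis UNIV_I)
  obtain \<delta> \<alpha> where "0 < \<delta>" "0 < \<alpha>"
    and \<alpha>: "\<And>x' y'. dist (fst l) x' < \<delta> \<Longrightarrow> dist (snd l) y' < \<delta> \<Longrightarrow> \<alpha> \<le> p (x', y')"
    using prob_exp_close_locally_pos[OF assms, of "fst l" "snd l"] by (auto simp: p_def)
  have "\<forall>\<^sub>F m in sequentially. dist (fst (z (r m))) (fst l) < \<delta> \<and> dist (snd (z (r m))) (snd l) < \<delta>"
    using tendstoD[OF tendsto_fst[OF lim] \<open>0 < \<delta>\<close>] tendstoD[OF tendsto_snd[OF lim] \<open>0 < \<delta>\<close>]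
    by (simp add: eventually_conj_iff)
  then have "\<forall>\<^sub>F m in sequentially. \<alpha> \<le> inverse (real (Suc (r m)))"
  proof eventually_elim
    case (elim m)
    then have "\<alpha> \<le> p (z (r m))"
      using \<alpha>[of "fst (z (r m))" "snd (z (r m))"] by (simp add: dist_commute)
    with z[of "r m"] show ?case by linarith
  qed
  moreover have "(\<lambda>m. inverse (real (Suc (r m)))) \<longlonglongrightarrow> 0"
    using LIMSEQ_subseq_LIMSEQ[OF LIMSEQ_inverse_real_of_nat \<open>strict_mono r\<close>] by (simp add: o_def)
  ultimately have "\<alpha> \<le> 0"
    by (intro tendsto_lowerbound) auto
  with \<open>0 < \<alpha>\<close> show False by simp
qed

text \<open>Whether the bound with constant \<open>m\<close> fails by time \<open>n\<close> is
  decided by the first \<open>n\<close> indices, so such a failure is still followed by closeness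
  with conditional probability at least \<open>\<alpha>\<close>. Hence \<open>\<alpha>\<close> times
  the probability of never being close is at most that of \<open>B m\<close>, for every
  \<open>m\<close>, and the latter tends to 0.\<close>

theorem AE_exp_close:
  assumes "proximal I f" and "local_contraction f \<mu> q" and "0 < q"
  shows "AE \<omega> in S. exp_close q x y \<omega>"
proof -
  let ?d = "\<lambda>\<omega> k. dist (iterate f \<omega> k x) (iterate f \<omega> k y)"
  obtain \<alpha> where "0 < \<alpha>" and \<alpha>: "\<And>x y. \<alpha> \<le> measure S {\<omega> \<in> space S. exp_close q x y \<omega>}"
    using prob_exp_close_uniformly_pos[OF assms] by blast
  define A where "A m n = {\<omega> \<in> space S. \<exists>k\<le>n. real m * q ^ k < ?d \<omega> k}" for m n :: nat
  define B where "B m = {\<omega> \<in> space S. (\<exists>k. real m * q ^ k < ?d \<omega> k) \<and> exp_close q x y \<omega>}" for m :: nat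
  have A_sets[measurable]: "A m n \<in> sets S" for m n
    unfolding A_def by measurable
  have B_sets[measurable]: "B m \<in> sets S" for m
    unfolding B_def by measurable
  have "\<alpha> * measure S (A m n) \<le> measure S (B m)" for m n
  proof -
    have "\<alpha> * measure S (A m n) \<le>
        measure S {\<omega> \<in> space S. (\<exists>k\<le>n. real m * q ^ k < ?d \<omega> k) \<and> exp_close q x y \<omega>}"
      unfolding A_def
    proof (rule prob_comb_seq_conj_ge[where n = n and P = "\<lambda>\<omega>. \<exists>k\<le>n. real m * q ^ k < ?d \<omega> k"])
      fix \<omega> assume [measurable]: "\<omega> \<in> space S"
      have "\<alpha> \<le> measure S {\<omega>' \<in> space S. exp_close q (iterate f \<omega> n x) (iterate f \<omega> n y) \<omega>'}"
        by (rule \<alpha>)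
      also have "\<dots> \<le> measure S {\<omega>' \<in> space S. exp_close q x y (comb_seq n \<omega> \<omega>')}"
      proof (rule P.finite_measure_mono)
        show "{\<omega>' \<in> space S. exp_close q (iterate f \<omega> n x) (iterate f \<omega> n y) \<omega>'} \<subseteq>
            {\<omega>' \<in> space S. exp_close q x y (comb_seq n \<omega> \<omega>')}"
          by (intro subsetI) (simp add: exp_close_comb_seq[OF \<open>0 < q\<close>])
      qed measurable
      finally show "\<alpha> \<le> measure S {\<omega>' \<in> space S. exp_close q x y (comb_seq n \<omega> \<omega>')}" .
    next
      show "(\<exists>k\<le>n. real m * q ^ k < ?d (comb_seq n \<omega> \<omega>') k) = (\<exists>k\<le>n. real m * q ^ k < ?d \<omega> k)" for \<omega> \<omega>'
        by (intro ex_cong1 conj_cong refl) (simp add: iterate_comb_seq_less)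
      show "Measurable.pred S (\<lambda>\<omega>. \<exists>k\<le>n. real m * q ^ k < ?d \<omega> k)"
        by measurable
      show "Measurable.pred S (exp_close q x y)"
        by measurable
    qed (use \<open>0 < \<alpha>\<close> in simp)
    also have "\<dots> \<le> measure S (B m)"
      by (intro P.finite_measure_mono) (auto simp: B_def)
    finally show ?thesis .
  qed
  moreover have "(\<lambda>n. \<alpha> * measure S (A m n)) \<longlonglongrightarrow> \<alpha> * measure S (\<Union>n. A m n)" for m
    by (intro tendsto_mult_left P.finite_Lim_measure_incseq)
      (auto simp: A_def incseq_def intro: order_trans)
  ultimately have "\<alpha> * measure S (\<Union>n. A m n) \<le> measure S (B m)" for m
    by (meson LIMSEQ_le_const2)
  \<comment> \<open>A path that is not exponentially close violates the bound for every
    \<open>m\<close>.\<close>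
  moreover have "measure S {\<omega> \<in> space S. \<not> exp_close q x y \<omega>} \<le> measure S (\<Union>n. A m n)" for m
    by (intro P.finite_measure_mono) (auto simp: A_def exp_close_def not_le, blast)
  ultimately have "\<alpha> * measure S {\<omega> \<in> space S. \<not> exp_close q x y \<omega>} \<le> measure S (B m)" for m
    using \<open>0 < \<alpha>\<close> by (meson mult_le_cancel_left_pos order_trans)
  moreover have "(\<lambda>m. measure S (B m)) \<longlonglongrightarrow> measure S (\<Inter>m. B m)"
  proof (rule P.finite_Lim_measure_decseq)
    have "real m * q ^ k \<le> real m' * q ^ k" if "m \<le> m'" for m m' k
      using that \<open>0 < q\<close> by (intro mult_right_mono) auto
    then show "decseq B"
      by (fastforce simp: B_def decseq_def intro: le_less_trans)
  qed auto
  \<comment> \<open>An exponentially close path obeys the bound for some \<open>m\<close>, which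
    excludes it from that \<open>B m\<close>.\<close>
  moreover have "(\<Inter>m. B m) = {}"
    by (fastforce simp: B_def exp_close_def not_less[symmetric])
  ultimately have "\<alpha> * measure S {\<omega> \<in> space S. \<not> exp_close q x y \<omega>} \<le> 0"
    by (intro LIMSEQ_le_const[of "\<lambda>m. measure S (B m)"]) simp_all
  then have "measure S {\<omega> \<in> space S. \<not> exp_close q x y \<omega>} = 0"
    using \<open>0 < \<alpha>\<close> by (simp add: mult_le_0_iff measure_le_0_iff)
  then show ?thesis
    by (subst (asm) P.prob_Collect_eq_0) auto
qed

section \<open>Synchronization, almost surely and uniformly in probability\<close>

lemma AE_dist_iterate_tendsto_0:
  assumes "proximal I f" and "local_contraction f \<mu> q" and "0 < q" "q < 1"
  shows "AE \<omega> in S. (\<lambda>n. dist (iterate f \<omega> n x) (iterate f \<omega> n y)) \<longlonglongrightarrow> 0"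
  using AE_exp_close[OF assms(1-3), of x y]
proof eventually_elim
  case (elim \<omega>)
  then obtain m :: nat where m: "\<And>n. dist (iterate f \<omega> n x) (iterate f \<omega> n y) \<le> real m * q ^ n"
    unfolding exp_close_def by blast
  have lim: "(\<lambda>n. real m * q ^ n) \<longlonglongrightarrow> 0"
    using assms(3,4) by (intro tendsto_mult_right_zero LIMSEQ_realpow_zero) simp_all
  show ?case
    by (rule tendsto_sandwich[OF _ _ tendsto_const lim]) (simp_all add: m)
qed

text \<open>Almost sure convergence gives convergence in probability by dominated convergence of
  indicators.\<close>

lemma prob_dist_iterate_tendsto_0:
  assumes "proximal I f" and "local_contraction f \<mu> q" and "0 < q" "q < 1" and "0 < e"
  shows "(\<lambda>n. measure S {\<omega> \<in> space S. e < dist (iterate f \<omega> n x) (iterate f \<omega> n y)}) \<longlonglongrightarrow> 0"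
proof -
  let ?A = "\<lambda>n. {\<omega> \<in> space S. e < dist (iterate f \<omega> n x) (iterate f \<omega> n y)}"
  have "(\<lambda>n. \<integral>\<omega>. indicator (?A n) \<omega> \<partial>S) \<longlonglongrightarrow> (\<integral>\<omega>. 0 \<partial>S :: real)"
  proof (rule integral_dominated_convergence[where w = "\<lambda>_. 1"])
    show "AE \<omega> in S. (\<lambda>n. indicator (?A n) \<omega> :: real) \<longlonglongrightarrow> 0"
      using AE_dist_iterate_tendsto_0[OF assms(1-4), of x y]
    proof eventually_elim
      case (elim \<omega>)
      have "\<forall>\<^sub>F n in sequentially. dist (iterate f \<omega> n x) (iterate f \<omega> n y) < e"
        using order_tendstoD(2)[OF elim \<open>0 < e\<close>] .
      then have "\<forall>\<^sub>F n in sequentially. (indicator (?A n) \<omega> :: real) = 0"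
        by eventually_elim auto
      then show ?case
        by (rule tendsto_eventually)
    qed
  qed (auto split: split_indicator)
  then show ?thesis
    by simp
qed

text \<open>If uniformity failed, bad pairs at times tending to infinity would accumulate at a pair
  \<open>(x, y)\<close>. Local contraction keeps their orbits near those of \<open>x\<close> and
  \<open>y\<close>, which synchronize in probability.\<close>

lemma prob_dist_iterate_uniform:
  assumes "proximal I f" and contr: "local_contraction f \<mu> q" and q: "0 < q" "q < 1" and "0 < e"
  shows "\<exists>N. \<forall>n\<ge>N. \<forall>x y.
    measure S {\<omega> \<in> space S. e < dist (iterate f \<omega> n x) (iterate f \<omega> n y)} \<le> e"
proof (rule ccontr)
  define p where "p c n z =
    measure S {\<omega> \<in> space S. c < dist (iterate f \<omega> n (fst z)) (iterate f \<omega> n (snd z))}" for c n z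
  assume "\<not> ?thesis"
  then have "\<not> (\<exists>N. \<forall>n\<ge>N. \<forall>x y. p e n (x, y) \<le> e)"
    by (simp add: p_def)
  then have "\<exists>n z. N \<le> n \<and> e < p e n z" for N
    using not_le by metis
  then obtain n z where n: "\<And>N. N \<le> n N" and z: "\<And>N. e < p e (n N) (z N)"
    by metis
  have "seq_compact (UNIV :: ('a \<times> 'a) set)"
    using compact_Times[OF compact compact] by (simp add: compact_eq_seq_compact_metric)
  then obtain l r where "strict_mono r" and lim: "(z \<circ> r) \<longlonglongrightarrow> l"
    unfolding seq_compact_def by (metis UNIV_I)
  define x y where "x = fst l" and "y = snd l"
  have n_lim: "filterlim (\<lambda>m. n (r m)) at_top sequentially"
    by (rule filterlim_at_top_mono[OF filterlim_ident])
      (auto intro!: always_eventually order_trans[OF seq_suble[OF \<open>strict_mono r\<close>] n])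
  \<comment> \<open>Local contraction with the centre as one of the two points, at a single time and
    in complementary form.\<close>
  have contr_near: "\<exists>\<rho>>0. \<forall>v n. dist u v < \<rho> \<longrightarrow> n \<ge> 1 \<longrightarrow>
      measure S {\<omega> \<in> space S. q ^ n < dist (iterate f \<omega> n u) (iterate f \<omega> n v)} \<le> e / 4" for u
  proof -
    obtain \<rho> where "0 < \<rho>" and \<rho>: "\<And>v w. dist u v < \<rho> \<Longrightarrow> dist u w < \<rho> \<Longrightarrow> 1 - e / 4 \<le>
        measure S {\<omega> \<in> space S. \<forall>n\<ge>1. dist (iterate f \<omega> n v) (iterate f \<omega> n w) \<le> q ^ n}"
      using local_contraction_prob_ge[OF contr, of "e / 4" u] \<open>0 < e\<close> by auto
    have "measure S {\<omega> \<in> space S. q ^ n < dist (iterate f \<omega> n u) (iterate f \<omega> n v)} \<le> e / 4"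
      if "dist u v < \<rho>" "n \<ge> 1" for v n
    proof -
      have "1 - e / 4 \<le> measure S {\<omega> \<in> space S. \<forall>n\<ge>1. dist (iterate f \<omega> n u) (iterate f \<omega> n v) \<le> q ^ n}"
        using \<rho>[of u v] that \<open>0 < \<rho>\<close> by simp
      also have "\<dots> \<le> measure S (space S - {\<omega> \<in> space S. q ^ n < dist (iterate f \<omega> n u) (iterate f \<omega> n v)})"
        using \<open>n \<ge> 1\<close> by (intro P.finite_measure_mono) (auto simp: not_less)
      also have "\<dots> = 1 - measure S {\<omega> \<in> space S. q ^ n < dist (iterate f \<omega> n u) (iterate f \<omega> n v)}"
        by (rule P.prob_compl) measurable
      finally show ?thesis by simp
    qed
    with \<open>0 < \<rho>\<close> show ?thesis by blast
  qed
  obtain \<rho>1 where "0 < \<rho>1" and \<rho>1: "\<And>v n. dist x v < \<rho>1 \<Longrightarrow> n \<ge> 1 \<Longrightarrow>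
      measure S {\<omega> \<in> space S. q ^ n < dist (iterate f \<omega> n x) (iterate f \<omega> n v)} \<le> e / 4"
    using contr_near[of x] by auto
  obtain \<rho>2 where "0 < \<rho>2" and \<rho>2: "\<And>v n. dist y v < \<rho>2 \<Longrightarrow> n \<ge> 1 \<Longrightarrow>
      measure S {\<omega> \<in> space S. q ^ n < dist (iterate f \<omega> n y) (iterate f \<omega> n v)} \<le> e / 4"
    using contr_near[of y] by auto
  have "(\<lambda>m. p (e / 3) (n (r m)) l) \<longlonglongrightarrow> 0"
    unfolding p_def using assms
    by (intro filterlim_compose[OF prob_dist_iterate_tendsto_0 n_lim]) auto
  then have "\<forall>\<^sub>F m in sequentially. p (e / 3) (n (r m)) l < e / 4"
    using \<open>0 < e\<close> by (intro order_tendstoD) auto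
  moreover have "(\<lambda>m. q ^ n (r m)) \<longlonglongrightarrow> 0"
    using q by (intro filterlim_compose[OF LIMSEQ_realpow_zero n_lim]) auto
  then have "\<forall>\<^sub>F m in sequentially. q ^ n (r m) < e / 3"
    using \<open>0 < e\<close> by (intro order_tendstoD) auto
  moreover have "\<forall>\<^sub>F m in sequentially. 1 \<le> n (r m)"
    using n_lim by (simp add: filterlim_at_top)
  moreover have "\<forall>\<^sub>F m in sequentially. dist (fst (z (r m))) x < \<rho>1"
    using tendstoD[OF tendsto_fst[OF lim] \<open>0 < \<rho>1\<close>] by (simp add: x_def)
  moreover have "\<forall>\<^sub>F m in sequentially. dist (snd (z (r m))) y < \<rho>2"
    using tendstoD[OF tendsto_snd[OF lim] \<open>0 < \<rho>2\<close>] by (simp add: y_def)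
  \<comment> \<open>Outside three events of total probability below \<open>e\<close>, the triangle
    inequality adds two distances at most \<open>q ^ n\<close>, each below \<open>e / 3\<close>, to
    one at most \<open>e / 3\<close>.\<close>
  ultimately have "\<forall>\<^sub>F m in sequentially. False"
  proof eventually_elim
    case (elim m)
    let ?n = "n (r m)" and ?x' = "fst (z (r m))" and ?y' = "snd (z (r m))"
    let ?X = "{\<omega> \<in> space S. q ^ ?n < dist (iterate f \<omega> ?n x) (iterate f \<omega> ?n ?x')}"
    let ?Y = "{\<omega> \<in> space S. q ^ ?n < dist (iterate f \<omega> ?n y) (iterate f \<omega> ?n ?y')}"
    let ?L = "{\<omega> \<in> space S. e / 3 < dist (iterate f \<omega> ?n x) (iterate f \<omega> ?n y)}"
    have "p e ?n (z (r m)) \<le> measure S (?X \<union> ?Y \<union> ?L)"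
      unfolding p_def
    proof (rule P.finite_measure_mono)
      show "{\<omega> \<in> space S. e < dist (iterate f \<omega> ?n ?x') (iterate f \<omega> ?n ?y')} \<subseteq> ?X \<union> ?Y \<union> ?L"
      proof (rule subsetI, rule ccontr)
        fix \<omega> assume \<omega>: "\<omega> \<in> {\<omega> \<in> space S. e < dist (iterate f \<omega> ?n ?x') (iterate f \<omega> ?n ?y')}"
          and "\<omega> \<notin> ?X \<union> ?Y \<union> ?L"
        then have "dist (iterate f \<omega> ?n x) (iterate f \<omega> ?n ?x') \<le> q ^ ?n"
          "dist (iterate f \<omega> ?n y) (iterate f \<omega> ?n ?y') \<le> q ^ ?n"
          "dist (iterate f \<omega> ?n x) (iterate f \<omega> ?n y) \<le> e / 3"
          by (auto simp: not_less)
        then have "dist (iterate f \<omega> ?n ?x') (iterate f \<omega> ?n ?y') < e"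
          using dist_triangle[of "iterate f \<omega> ?n ?x'" "iterate f \<omega> ?n ?y'" "iterate f \<omega> ?n x"]
            dist_triangle[of "iterate f \<omega> ?n x" "iterate f \<omega> ?n ?y'" "iterate f \<omega> ?n y"]
            elim(2) by (simp add: dist_commute)
        with \<omega> show False by simp
      qed
    qed measurable
    also have "\<dots> \<le> measure S ?X + measure S ?Y + measure S ?L"
      by (intro order_trans[OF measure_Un_le] add_mono) auto
    also have "measure S ?X \<le> e / 4"
      using elim by (intro \<rho>1) (auto simp: dist_commute)
    also have "measure S ?Y \<le> e / 4"
      using elim by (intro \<rho>2) (auto simp: dist_commute)
    also have "measure S ?L < e / 4"
      using elim(1) by (simp add: p_def x_def y_def)
    finally have "p e ?n (z (r m)) < e"
      using \<open>0 < e\<close> by simp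
    with z[of "r m"] show ?case by simp
  qed
  then show False by simp
qed

subsection \<open>Stationary measures\<close>

lemma nn_integral_case_nat:
  assumes [measurable]: "h \<in> borel_measurable S"
  shows "(\<integral>\<^sup>+ \<omega>. h \<omega> \<partial>S) = (\<integral>\<^sup>+ i. \<integral>\<^sup>+ \<omega>. h (case_nat i \<omega>) \<partial>S \<partial>\<mu>)"
proof -
  have [measurable]: "(\<lambda>(i, \<omega>). case_nat i \<omega>) \<in> measurable (\<mu> \<Otimes>\<^sub>M S) S"
    by measurable
  have "(\<integral>\<^sup>+ \<omega>. h \<omega> \<partial>S) = (\<integral>\<^sup>+ \<omega>. h \<omega> \<partial>distr (\<mu> \<Otimes>\<^sub>M S) S (\<lambda>(i, \<omega>). case_nat i \<omega>))"
    by (simp add: PiM_iter)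
  also have "\<dots> = (\<integral>\<^sup>+ p. h (case_nat (fst p) (snd p)) \<partial>(\<mu> \<Otimes>\<^sub>M S))"
    by (subst nn_integral_distr) (auto simp: split_beta')
  also have "\<dots> = (\<integral>\<^sup>+ i. \<integral>\<^sup>+ \<omega>. h (case_nat i \<omega>) \<partial>S \<partial>\<mu>)"
    by (subst P.nn_integral_fst[symmetric]) auto
  finally show ?thesis .
qed

lemma iterate_case_nat: "iterate f (case_nat i \<omega>) (Suc n) x = iterate f \<omega> n (f i x)"
  using iterate_add[of "case_nat i \<omega>" 1 n x] by simp

text \<open>The induction peels off the map that is applied first; stationarity is then used for the
  preimage of \<open>A\<close> under the remaining \<open>n\<close> maps.\<close>

lemma stationary_emeasure_iterate:
  assumes stat: "stationary f \<mu> \<nu>" and A[measurable]: "A \<in> sets borel"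
  shows "emeasure \<nu> A = (\<integral>\<^sup>+ \<omega>. emeasure \<nu> {x. iterate f \<omega> n x \<in> A} \<partial>S)"
proof (induction n)
  case 0
  then show ?case
    using P.emeasure_space_1 by simp
next
  case (Suc n)
  have [measurable_cong]: "sets \<nu> = sets borel"
    using stat by (simp add: stationary_def)
  have [simp]: "space \<nu> = UNIV"
    using sets_eq_imp_space_eq[OF \<open>sets \<nu> = sets borel\<close>] by simp
  interpret nu: prob_space \<nu>
    using stat by (simp add: stationary_def)
  interpret muS: pair_sigma_finite \<mu> S ..
  \<comment> \<open>The function is the measure of sections of a set in a triple product; its joint
    measurability licenses the exchange of integrals below.\<close>
  have meas[measurable]: "(\<lambda>p. emeasure \<nu> {x. iterate f (fst p) n (f (snd p) x) \<in> A}) \<in> borel_measurable (S \<Otimes>\<^sub>M \<mu>)"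
  proof -
    have "{t \<in> space ((S \<Otimes>\<^sub>M \<mu>) \<Otimes>\<^sub>M \<nu>). iterate f (fst (fst t)) n (f (snd (fst t)) (snd t)) \<in> A} \<in>
        sets ((S \<Otimes>\<^sub>M \<mu>) \<Otimes>\<^sub>M \<nu>)"
      by measurable
    from nu.measurable_emeasure_Pair[OF this] show ?thesis
      by (rule measurable_cong[THEN iffD1, rotated])
        (auto simp: space_pair_measure intro!: arg_cong2[where f = emeasure])
  qed
  have "(\<integral>\<^sup>+ \<omega>. emeasure \<nu> {x. iterate f \<omega> (Suc n) x \<in> A} \<partial>S) =
      (\<integral>\<^sup>+ i. \<integral>\<^sup>+ \<omega>. emeasure \<nu> {x. iterate f \<omega> n (f i x) \<in> A} \<partial>S \<partial>\<mu>)"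
  proof (subst nn_integral_case_nat)
    have "{t \<in> space (S \<Otimes>\<^sub>M \<nu>). iterate f (fst t) (Suc n) (snd t) \<in> A} \<in> sets (S \<Otimes>\<^sub>M \<nu>)"
      by measurable
    from nu.measurable_emeasure_Pair[OF this]
    show "(\<lambda>\<omega>. emeasure \<nu> {x. iterate f \<omega> (Suc n) x \<in> A}) \<in> borel_measurable S"
      by (rule measurable_cong[THEN iffD1, rotated])
        (auto simp: space_pair_measure intro!: arg_cong2[where f = emeasure])
  qed (simp add: iterate_case_nat del: iterate.simps)
  \<comment> \<open>With \<open>\<omega>\<close> frozen, the inner integral over \<open>i\<close> is
    the one in the definition of \<open>stationary\<close>.\<close>
  also have "\<dots> = (\<integral>\<^sup>+ \<omega>. \<integral>\<^sup>+ i. emeasure \<nu> {x. iterate f \<omega> n (f i x) \<in> A} \<partial>\<mu> \<partial>S)"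
    by (rule muS.Fubini'[symmetric]) (use meas in \<open>simp add: split_beta'\<close>)
  also have "\<dots> = (\<integral>\<^sup>+ \<omega>. emeasure \<nu> {x. iterate f \<omega> n x \<in> A} \<partial>S)"
  proof (rule nn_integral_cong)
    fix \<omega> assume [measurable]: "\<omega> \<in> space S"
    have [measurable]: "{x. iterate f \<omega> n x \<in> A} \<in> sets borel"
      using borel_measurable_continuous_onI[OF continuous_on_iterate[of \<omega> n]] A
      by (auto simp: measurable_def vimage_def)
    have [measurable]: "apply_bcontfun (f i) \<in> borel_measurable borel" for i
      by (intro borel_measurable_continuous_onI) simp
    have "emeasure \<nu> {x. iterate f \<omega> n (f i x) \<in> A} =
        emeasure (distr \<nu> borel (apply_bcontfun (f i))) {x. iterate f \<omega> n x \<in> A}" for i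
      by (subst emeasure_distr) (auto simp: vimage_def)
    then show "(\<integral>\<^sup>+ i. emeasure \<nu> {x. iterate f \<omega> n (f i x) \<in> A} \<partial>\<mu>) = emeasure \<nu> {x. iterate f \<omega> n x \<in> A}"
      using stat unfolding stationary_def by simp
  qed
  also have "\<dots> = emeasure \<nu> A"
    by (rule Suc[symmetric])
  finally show ?case ..
qed

text \<open>By Fubini, \<open>\<nu>\<close> is the average over starting points of the laws after
  \<open>n\<close> steps, so bounds uniform in the starting point pass to
  \<open>\<nu>\<close>.\<close>

lemma stationary_emeasure_eq_nn_integral:
  assumes stat: "stationary f \<mu> \<nu>" and A[measurable]: "A \<in> sets borel"
  shows "emeasure \<nu> A = (\<integral>\<^sup>+ x. emeasure S {\<omega> \<in> space S. iterate f \<omega> n x \<in> A} \<partial>\<nu>)"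
proof -
  have [measurable_cong]: "sets \<nu> = sets borel"
    using stat by (simp add: stationary_def)
  have [simp]: "space \<nu> = UNIV"
    using sets_eq_imp_space_eq[OF \<open>sets \<nu> = sets borel\<close>] by simp
  interpret nu: prob_space \<nu>
    using stat by (simp add: stationary_def)
  interpret nuS: pair_sigma_finite \<nu> S ..
  let ?Q = "{t \<in> space (\<nu> \<Otimes>\<^sub>M S). iterate f (snd t) n (fst t) \<in> A}"
  have Q: "?Q \<in> sets (\<nu> \<Otimes>\<^sub>M S)"
    by measurable
  have "emeasure \<nu> A = (\<integral>\<^sup>+ \<omega>. emeasure \<nu> ((\<lambda>x. (x, \<omega>)) -` ?Q) \<partial>S)"
    unfolding stationary_emeasure_iterate[OF assms, of n]
    by (intro nn_integral_cong arg_cong2[where f = emeasure]) (auto simp: space_pair_measure)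
  also have "\<dots> = (\<integral>\<^sup>+ x. emeasure S (Pair x -` ?Q) \<partial>\<nu>)"
    using nuS.emeasure_pair_measure_alt2[OF Q] P.emeasure_pair_measure_alt[OF Q] by simp
  also have "\<dots> = (\<integral>\<^sup>+ x. emeasure S {\<omega> \<in> space S. iterate f \<omega> n x \<in> A} \<partial>\<nu>)"
    by (intro nn_integral_cong arg_cong2[where f = emeasure]) (auto simp: space_pair_measure)
  finally show ?thesis .
qed

lemma stationary_measure_le:
  assumes stat: "stationary f \<mu> \<nu>" and A: "A \<in> sets borel"
    and le: "\<And>x. measure S {\<omega> \<in> space S. iterate f \<omega> n x \<in> A} \<le> c"
  shows "measure \<nu> A \<le> c"
proof -
  interpret nu: prob_space \<nu>
    using stat by (simp add: stationary_def)
  have "0 \<le> c"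
    using le measure_nonneg order_trans by blast
  have "emeasure \<nu> A \<le> (\<integral>\<^sup>+ x. ennreal c \<partial>\<nu>)"
    unfolding stationary_emeasure_eq_nn_integral[OF stat A, of n]
    by (intro nn_integral_mono) (simp add: P.emeasure_eq_measure le ennreal_leI)
  also have "\<dots> = ennreal c"
    by (simp add: nu.emeasure_space_1)
  finally show ?thesis
    using \<open>0 \<le> c\<close> by (simp add: nu.emeasure_eq_measure)
qed

lemma stationary_measure_ge:
  assumes stat: "stationary f \<mu> \<nu>" and A: "A \<in> sets borel"
    and ge: "\<And>x. c \<le> measure S {\<omega> \<in> space S. iterate f \<omega> n x \<in> A}"
  shows "c \<le> measure \<nu> A"
proof -
  interpret nu: prob_space \<nu>
    using stat by (simp add: stationary_def)
  have "ennreal c = (\<integral>\<^sup>+ x. ennreal c \<partial>\<nu>)"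
    by (simp add: nu.emeasure_space_1)
  also have "\<dots> \<le> emeasure \<nu> A"
    unfolding stationary_emeasure_eq_nn_integral[OF stat A, of n]
    by (intro nn_integral_mono) (simp add: P.emeasure_eq_measure ge ennreal_leI)
  finally show ?thesis
    by (simp add: nu.emeasure_eq_measure)
qed

text \<open>Both measures are compared with the law after \<open>n\<close> steps from one reference
  point, and each comparison enlarges \<open>F\<close> by \<open>e\<close>. The empty set is
  excluded because \<open>infdist\<close> to it is 0 by convention.\<close>

lemma stationary_measure_closed_le:
  assumes sync: "proximal I f" "local_contraction f \<mu> q" "0 < q" "q < 1"
    and stat: "stationary f \<mu> \<nu>" "stationary f \<mu> \<nu>'" and F: "closed F" "F \<noteq> {}"
  shows "measure \<nu> F \<le> measure \<nu>' F"
proof -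
  interpret nu': prob_space \<nu>'
    using stat by (simp add: stationary_def)
  have sets_nu': "sets \<nu>' = sets borel"
    using stat by (simp add: stationary_def)
  define G where "G e = {x. infdist x F \<le> e}" for e
  have G_closed: "closed (G e)" for e
    unfolding G_def by (intro closed_Collect_le continuous_intros)
  then have [measurable]: "G e \<in> sets borel" for e
    by simp
  have [measurable]: "F \<in> sets borel"
    using F by simp
  have approx: "measure \<nu> F \<le> measure \<nu>' (G (2 * e)) + 2 * e" if "0 < e" for e
  proof -
    \<comment> \<open>Any state serves as reference point; the type is inhabited.\<close>
    fix x0 :: 'a
    obtain n where n: "\<And>x y. measure S {\<omega> \<in> space S. e < dist (iterate f \<omega> n x) (iterate f \<omega> n y)} \<le> e"
      using prob_dist_iterate_uniform[OF sync \<open>0 < e\<close>] by blast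
    define L where "L = measure S {\<omega> \<in> space S. iterate f \<omega> n x0 \<in> G e}"
    have "measure \<nu> F \<le> L + e"
    proof (rule stationary_measure_le[OF stat(1)])
      fix x
      let ?D = "{\<omega> \<in> space S. e < dist (iterate f \<omega> n x0) (iterate f \<omega> n x)}"
      have "measure S {\<omega> \<in> space S. iterate f \<omega> n x \<in> F} \<le>
          measure S ({\<omega> \<in> space S. iterate f \<omega> n x0 \<in> G e} \<union> ?D)"
      proof (rule P.finite_measure_mono)
        show "{\<omega> \<in> space S. iterate f \<omega> n x \<in> F} \<subseteq> {\<omega> \<in> space S. iterate f \<omega> n x0 \<in> G e} \<union> ?D"
        proof (rule subsetI)
          fix \<omega> assume "\<omega> \<in> {\<omega> \<in> space S. iterate f \<omega> n x \<in> F}"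
          then show "\<omega> \<in> {\<omega> \<in> space S. iterate f \<omega> n x0 \<in> G e} \<union> ?D"
            using infdist_le[of "iterate f \<omega> n x" F "iterate f \<omega> n x0"]
            by (auto simp: G_def)
        qed
      qed measurable
      also have "\<dots> \<le> L + measure S ?D"
        unfolding L_def by (rule measure_Un_le) measurable
      finally show "measure S {\<omega> \<in> space S. iterate f \<omega> n x \<in> F} \<le> L + e"
        using n[of x0 x] by simp
    qed measurable
    moreover have "L - e \<le> measure \<nu>' (G (2 * e))"
    proof (rule stationary_measure_ge[OF stat(2)])
      fix x
      let ?D = "{\<omega> \<in> space S. e < dist (iterate f \<omega> n x) (iterate f \<omega> n x0)}"
      have "L \<le> measure S ({\<omega> \<in> space S. iterate f \<omega> n x \<in> G (2 * e)} \<union> ?D)"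
        unfolding L_def
      proof (rule P.finite_measure_mono)
        show "{\<omega> \<in> space S. iterate f \<omega> n x0 \<in> G e} \<subseteq> {\<omega> \<in> space S. iterate f \<omega> n x \<in> G (2 * e)} \<union> ?D"
        proof (rule subsetI)
          fix \<omega> assume "\<omega> \<in> {\<omega> \<in> space S. iterate f \<omega> n x0 \<in> G e}"
          then show "\<omega> \<in> {\<omega> \<in> space S. iterate f \<omega> n x \<in> G (2 * e)} \<union> ?D"
            using infdist_triangle[of "iterate f \<omega> n x" F "iterate f \<omega> n x0"]
            by (auto simp: G_def)
        qed
      qed measurable
      also have "\<dots> \<le> measure S {\<omega> \<in> space S. iterate f \<omega> n x \<in> G (2 * e)} + measure S ?D"
        by (rule measure_Un_le) measurable
      finally show "L - e \<le> measure S {\<omega> \<in> space S. iterate f \<omega> n x \<in> G (2 * e)}"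
        using n[of x x0] by simp
    qed measurable
    ultimately show ?thesis by simp
  qed
  define \<epsilon> where "\<epsilon> m = inverse (real (Suc m))" for m
  have \<epsilon>: "\<epsilon> \<longlonglongrightarrow> 0"
    unfolding \<epsilon>_def by (rule LIMSEQ_inverse_real_of_nat)
  have "(\<lambda>m. measure \<nu>' (G (2 * \<epsilon> m))) \<longlonglongrightarrow> measure \<nu>' (\<Inter>m. G (2 * \<epsilon> m))"
  proof (rule nu'.finite_Lim_measure_decseq)
    have "\<epsilon> m' \<le> \<epsilon> m" if "m \<le> m'" for m m'
      using that unfolding \<epsilon>_def by (intro le_imp_inverse_le) auto
    then show "decseq (\<lambda>m. G (2 * \<epsilon> m))"
      by (fastforce simp: decseq_def G_def)
    show "range (\<lambda>m. G (2 * \<epsilon> m)) \<subseteq> sets \<nu>'"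
      using G_closed by (simp add: sets_nu' image_subset_iff)
  qed
  also have "(\<Inter>m. G (2 * \<epsilon> m)) = F"
  proof (intro equalityI subsetI)
    fix x assume "x \<in> (\<Inter>m. G (2 * \<epsilon> m))"
    then have "infdist x F \<le> 2 * \<epsilon> m" for m
      by (auto simp: G_def)
    moreover have "(\<lambda>m. 2 * \<epsilon> m) \<longlonglongrightarrow> 2 * 0"
      by (intro tendsto_intros \<epsilon>)
    ultimately have "infdist x F \<le> 2 * 0"
      by (intro LIMSEQ_le_const[of "\<lambda>m. 2 * \<epsilon> m"]) auto
    then have "infdist x F = 0"
      using infdist_nonneg[of x F] by simp
    then show "x \<in> F"
      by (simp add: in_closed_iff_infdist_zero[OF F])
  next
    fix x assume "x \<in> F"
    then show "x \<in> (\<Inter>m. G (2 * \<epsilon> m))"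
      by (simp add: G_def \<epsilon>_def)
  qed
  finally have "(\<lambda>m. measure \<nu>' (G (2 * \<epsilon> m)) + 2 * \<epsilon> m) \<longlonglongrightarrow> measure \<nu>' F + 2 * 0"
    by (intro tendsto_intros \<epsilon>)
  then have "measure \<nu> F \<le> measure \<nu>' F + 2 * 0"
    by (rule LIMSEQ_le_const) (use approx in \<open>simp add: \<epsilon>_def\<close>)
  then show ?thesis by simp
qed

text \<open>Closed sets form an intersection-stable generator of the Borel sets, and the one-sided
  comparison applies in both directions.\<close>

theorem stationary_unique:
  assumes sync: "proximal I f" "local_contraction f \<mu> q" "0 < q" "q < 1"
    and stat: "stationary f \<mu> \<nu>" "stationary f \<mu> \<nu>'"
  shows "\<nu> = \<nu>'"
proof (rule measure_eqI_generator_eq[where E = "Collect closed" and \<Omega> = UNIV and A = "\<lambda>_. UNIV"])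
  interpret nu: prob_space \<nu>
    using stat by (simp add: stationary_def)
  interpret nu': prob_space \<nu>'
    using stat by (simp add: stationary_def)
  show "Int_stable (Collect closed)"
    by (auto simp: Int_stable_def)
  show "emeasure \<nu> X = emeasure \<nu>' X" if "X \<in> Collect closed" for X :: "'a set"
  proof (cases "X = {}")
    case False
    then have "measure \<nu> X = measure \<nu>' X"
      using stationary_measure_closed_le[OF sync stat] stationary_measure_closed_le[OF sync stat(2,1)] that
      by (intro antisym) auto
    then show ?thesis
      by (simp add: nu.emeasure_eq_measure nu'.emeasure_eq_measure)
  qed simp
  show "sets \<nu> = sigma_sets UNIV (Collect closed)" "sets \<nu>' = sigma_sets UNIV (Collect closed)"
    using stat by (simp_all add: stationary_def borel_eq_closed)
  show "emeasure \<nu> UNIV \<noteq> \<infinity>"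
    by simp
qed auto

section \<open>Backward iterates and existence of a stationary measure\<close>

definition reverse_prefix :: "nat \<Rightarrow> (nat \<Rightarrow> 'i) \<Rightarrow> nat \<Rightarrow> 'i" where
  "reverse_prefix n \<omega> k = \<omega> (if k < n then n - 1 - k else k)"

lemma measurable_reverse_prefix [measurable]: "reverse_prefix n \<in> measurable S S"
  unfolding reverse_prefix_def[abs_def] by (rule measurable_PiM_single') (auto simp: space_PiM PiE_iff)

text \<open>Since entries from \<open>n\<close> on stay in place, the reversal permutes the
  coordinates, and a product of identical factors is invariant under injective reindexing.\<close>

lemma distr_reverse_prefix: "distr S S (reverse_prefix n) = S"
proof -
  let ?\<pi> = "\<lambda>k. if k < n then n - 1 - k else k"
  have "inj ?\<pi>"
    by (auto simp: inj_on_def split: if_splits)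
  from distr_PiM_reindex[of UNIV "\<lambda>_. \<mu>" ?\<pi> UNIV, OF _ this] show ?thesis
    by (simp add: reverse_prefix_def[abs_def] restrict_UNIV mu.prob_space_axioms)
qed

lemma prob_reverse_prefix:
  assumes [measurable]: "Measurable.pred S Q"
  shows "measure S {\<omega> \<in> space S. Q (reverse_prefix n \<omega>)} = measure S {\<omega> \<in> space S. Q \<omega>}"
proof -
  have "measure S {\<omega> \<in> space S. Q \<omega>} = measure (distr S S (reverse_prefix n)) {\<omega> \<in> space S. Q \<omega>}"
    by (simp add: distr_reverse_prefix)
  also have "\<dots> = measure S {\<omega> \<in> space S. Q (reverse_prefix n \<omega>)}"
    using measurable_space[OF measurable_reverse_prefix]
    by (subst measure_distr) (auto intro!: arg_cong2[where f = measure])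
  finally show ?thesis ..
qed

text \<open>
  For fixed \<open>n\<close>, the map \<open>backward \<omega> n\<close>, which is \<open>f (\<omega> 0) \<circ> \<dots> \<circ> f (\<omega> (n - 1))\<close>, has the law
  of the forward iterate, but as \<open>n\<close> grows it converges along a subsequence.
\<close>

definition backward :: "(nat \<Rightarrow> 'i) \<Rightarrow> nat \<Rightarrow> 'a \<Rightarrow> 'a" where
  "backward \<omega> n = iterate f (reverse_prefix n \<omega>) n"

lemma measurable_backward [measurable]: "(\<lambda>\<omega>. backward \<omega> n x) \<in> borel_measurable S"
  unfolding backward_def by measurable

text \<open>A prepended index becomes the outermost map here, not the innermost as in the forward
  iterate. In the limit this turns into equivariance.\<close>

lemma backward_case_nat: "backward (case_nat i \<omega>) (Suc n) x = f i (backward \<omega> n x)"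
proof -
  have "iterate f (reverse_prefix (Suc n) (case_nat i \<omega>)) n = iterate f (reverse_prefix n \<omega>) n"
    by (intro iterate_cong) (auto simp: reverse_prefix_def intro!: arg_cong[where f = \<omega>] split: nat.split)
  then show ?thesis
    by (simp add: backward_def) (simp add: reverse_prefix_def)
qed

text \<open>Both compositions share their \<open>n\<close> outermost maps. After reversing the first
  \<open>k\<close> indices these are the last \<open>n\<close> maps of a forward path, applied to
  \<open>x\<close> and to \<open>iterate f \<omega> m x\<close>; the latter depends only on the
  first \<open>m\<close> indices, so the uniform bound applies conditionally.\<close>

lemma prob_dist_backward_le:
  assumes n: "\<And>x y. measure S {\<omega> \<in> space S. e < dist (iterate f \<omega> n x) (iterate f \<omega> n y)} \<le> e"
    and "n \<le> k"
  shows "measure S {\<omega> \<in> space S. e < dist (backward \<omega> k x) (backward \<omega> n x)} \<le> e"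
proof -
  obtain m where k: "k = m + n"
    using \<open>n \<le> k\<close> by (metis le_add_diff_inverse2)
  define Q where "Q \<omega> \<longleftrightarrow> e < dist (iterate f \<omega> (m + n) x) (iterate f (\<lambda>k. \<omega> (k + m)) n x)" for \<omega>
  have [measurable]: "(\<lambda>\<omega> k. \<omega> (k + m)) \<in> measurable S S"
    by (rule measurable_PiM_single') (auto simp: space_PiM PiE_iff)
  have Q_meas[measurable]: "Measurable.pred S Q"
    unfolding Q_def by measurable
  have "backward \<omega> n x = iterate f (\<lambda>k. reverse_prefix (m + n) \<omega> (k + m)) n x" for \<omega>
    unfolding backward_def by (intro fun_cong[OF iterate_cong]) (simp add: reverse_prefix_def)
  then have "measure S {\<omega> \<in> space S. e < dist (backward \<omega> k x) (backward \<omega> n x)} =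
      measure S {\<omega> \<in> space S. Q (reverse_prefix (m + n) \<omega>)}"
    by (simp add: Q_def k backward_def)
  also have "\<dots> = measure S {\<omega> \<in> space S. Q \<omega>}"
    by (rule prob_reverse_prefix) measurable
  also have "\<dots> \<le> e"
  proof (rule prob_comb_seq_le[where n = m])
    show "measure S {\<omega>' \<in> space S. Q (comb_seq m \<omega> \<omega>')} \<le> e" for \<omega>
      using n[of "iterate f \<omega> m x" x] by (simp add: Q_def iterate_comb_seq comb_seq_add)
  qed measurable
  finally show ?thesis .
qed

lemma AE_case_nat:
  assumes "AE \<omega> in S. Q \<omega>"
  shows "AE i in \<mu>. AE \<omega> in S. Q (case_nat i \<omega>)"
proof -
  interpret muS: pair_sigma_finite \<mu> S ..
  have meas: "(\<lambda>p. case_nat (fst p) (snd p)) \<in> measurable (\<mu> \<Otimes>\<^sub>M S) S"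
    by measurable
  have "distr (\<mu> \<Otimes>\<^sub>M S) S (\<lambda>p. case_nat (fst p) (snd p)) = S"
    using PiM_iter by (simp add: split_beta')
  then have "AE p in \<mu> \<Otimes>\<^sub>M S. Q (case_nat (fst p) (snd p))"
    using assms by (intro AE_distrD[OF meas, where P = Q]) (simp only:)
  from muS.AE_pair[OF this] show ?thesis
    by simp
qed

text \<open>In the manner of Letac's principle, the limit \<open>Y\<close> of backward iterates
  along sparse times satisfies \<open>Y (case_nat i \<omega>) = f i (Y \<omega>)\<close> almost
  surely. As \<open>i\<close> is independent of \<open>\<omega>\<close>, the law of \<open>Y\<close>
  is stationary.\<close>

theorem stationary_exists:
  assumes sync: "proximal I f" "local_contraction f \<mu> q" "0 < q" "q < 1"
  shows "\<exists>\<nu>. stationary f \<mu> \<nu>"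
proof -
  fix x0 :: 'a
  define R where "R k N \<longleftrightarrow> (\<forall>n\<ge>N. \<forall>x y. measure S {\<omega> \<in> space S.
      (1 / 2) ^ k < dist (iterate f \<omega> n x) (iterate f \<omega> n y)} \<le> (1 / 2) ^ k)" for k N :: nat
  have "\<exists>N. R k N" for k
    unfolding R_def by (rule prob_dist_iterate_uniform[OF sync]) simp
  then obtain N where "\<And>k. R k (N k)"
    by metis
  then have N: "measure S {\<omega> \<in> space S. (1 / 2) ^ k < dist (iterate f \<omega> n x) (iterate f \<omega> n y)} \<le> (1 / 2) ^ k"
    if "N k \<le> n" for k n x y
    using that by (simp add: R_def)
  \<comment> \<open>The sum puts \<open>r k\<close> above \<open>N k\<close>, and the summand
    \<open>k\<close> makes \<open>r\<close> strictly increasing.\<close>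
  define r where "r k = k + (\<Sum>j\<le>k. N j)" for k
  have N_le_r: "N k \<le> r k" for k
    unfolding r_def using member_le_sum[of k "{..k}" N] by simp
  have r_less: "r k < r (Suc k)" for k
    by (simp add: r_def)
  \<comment> \<open>Borel-Cantelli with a geometric series. The later time \<open>l\<close> is left
    free: \<open>r (Suc k)\<close> yields convergence, \<open>Suc (r k)\<close> the equivariance of
    the limit.\<close>
  have tail: "AE \<omega> in S. \<forall>\<^sub>F k in sequentially. dist (backward \<omega> (l k) x0) (backward \<omega> (r k) x0) \<le> (1 / 2) ^ k"
    if "\<And>k. r k \<le> l k" for l
  proof -
    let ?A = "\<lambda>k. {\<omega> \<in> space S. (1 / 2) ^ k < dist (backward \<omega> (l k) x0) (backward \<omega> (r k) x0)}"
    have "measure S (?A k) \<le> (1 / 2) ^ k" for k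
      by (rule prob_dist_backward_le[OF N[OF N_le_r] that])
    then have "summable (\<lambda>k. measure S (?A k))"
      by (intro summable_comparison_test[OF _ summable_geometric[of "1 / 2 :: real"]]) auto
    then have "AE \<omega> in S. \<forall>\<^sub>F k in sequentially. \<omega> \<in> space S - ?A k"
      by (intro borel_cantelli_AE1) (auto simp: P.emeasure_eq_measure)
    then show ?thesis
    proof eventually_elim
      case (elim \<omega>)
      then show ?case
        by eventually_elim (auto simp: not_less)
    qed
  qed
  define G where "G \<omega> \<longleftrightarrow>
    (\<exists>K. \<forall>k\<ge>K. dist (backward \<omega> (r (Suc k)) x0) (backward \<omega> (r k) x0) \<le> (1 / 2) ^ k)" for \<omega>
  have G_meas[measurable]: "Measurable.pred S G"
    unfolding G_def by measurable
  have AE_G: "AE \<omega> in S. G \<omega>"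
    using tail[of "\<lambda>k. r (Suc k)"] r_less by (simp add: G_def eventually_sequentially less_imp_le)
  \<comment> \<open>The default \<open>x0\<close> outside the almost sure event makes the sequence
    converge on every path, so that \<open>Y\<close> is measurable as a pointwise limit.\<close>
  define Z where "Z k \<omega> = (if G \<omega> then backward \<omega> (r k) x0 else x0)" for k \<omega>
  have Z_meas[measurable]: "Z k \<in> borel_measurable S" for k
    unfolding Z_def by measurable
  have "\<exists>y. (\<lambda>k. Z k \<omega>) \<longlonglongrightarrow> y" for \<omega>
  proof -
    have "Cauchy (\<lambda>k. Z k \<omega>)"
    proof (cases "G \<omega>")
      case True
      then show ?thesis
        by (auto simp: Z_def G_def intro: Cauchy_if_dist_Suc_le_half_power)
    qed (simp add: Z_def convergent_Cauchy convergent_const)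
    then show ?thesis
      using compact_imp_complete[OF compact] by (auto simp: complete_def)
  qed
  then obtain Y where Z_lim: "\<And>\<omega>. (\<lambda>k. Z k \<omega>) \<longlonglongrightarrow> Y \<omega>"
    by metis
  have Y_meas[measurable]: "Y \<in> borel_measurable S"
    by (rule borel_measurable_LIMSEQ_metric[OF Z_meas Z_lim])
  have backward_lim: "(\<lambda>k. backward \<omega> (r k) x0) \<longlonglongrightarrow> Y \<omega>" if "G \<omega>" for \<omega>
    using Z_lim[of \<omega>] that by (simp add: Z_def)
  \<comment> \<open>Prepending an index adds one map, so the same limit is needed along the shifted
    times.\<close>
  have "AE \<omega> in S. (\<lambda>k. backward \<omega> (Suc (r k)) x0) \<longlonglongrightarrow> Y \<omega>"
    using AE_G tail[of "\<lambda>k. Suc (r k)", OF le_SucI[OF order_refl]]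
  proof eventually_elim
    case (elim \<omega>)
    have "(\<lambda>k. dist (backward \<omega> (Suc (r k)) x0) (backward \<omega> (r k) x0)) \<longlonglongrightarrow> 0"
      by (rule tendsto_sandwich[OF _ elim(2) tendsto_const LIMSEQ_realpow_zero]) simp_all
    moreover have "(\<lambda>k. dist (backward \<omega> (r k) x0) (Y \<omega>)) \<longlonglongrightarrow> 0"
      using backward_lim[OF elim(1)] by (rule tendsto_dist_iff[THEN iffD1])
    ultimately have sum: "(\<lambda>k. dist (backward \<omega> (Suc (r k)) x0) (backward \<omega> (r k) x0) +
        dist (backward \<omega> (r k) x0) (Y \<omega>)) \<longlonglongrightarrow> 0"
      by (rule tendsto_add_zero)
    have "(\<lambda>k. dist (backward \<omega> (Suc (r k)) x0) (Y \<omega>)) \<longlonglongrightarrow> 0"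
      by (rule tendsto_sandwich[OF _ _ tendsto_const sum]) (simp_all add: dist_triangle)
    then show ?case
      by (rule tendsto_dist_iff[THEN iffD2])
  qed
  from AE_case_nat[OF this]
  have Y_equivariant: "AE i in \<mu>. AE \<omega> in S. Y (case_nat i \<omega>) = f i (Y \<omega>)"
  proof eventually_elim
    case (elim i)
    then show ?case
      using AE_G
    proof eventually_elim
      case (elim \<omega>)
      \<comment> \<open>By \<open>backward_case_nat\<close> this is also the sequence along
        \<open>Suc (r k)\<close> for the path with \<open>i\<close> prepended, so the two limits
        agree.\<close>
      have "(\<lambda>k. f i (backward \<omega> (r k) x0)) \<longlonglongrightarrow> f i (Y \<omega>)"
        using continuous_on_tendsto_compose[OF continuous_on_apply_bcontfun backward_lim[OF elim(2)], of UNIV]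
        by simp
      with elim(1) show ?case
        by (intro LIMSEQ_unique[of "\<lambda>k. f i (backward \<omega> (r k) x0)"]) (simp_all only: backward_case_nat)
    qed
  qed
  have map_meas[measurable]: "apply_bcontfun (f i) \<in> borel_measurable borel" for i
    by (intro borel_measurable_continuous_onI) simp
  have "stationary f \<mu> (distr S borel Y)"
    unfolding stationary_def
  proof (intro conjI ballI)
    show "prob_space (distr S borel Y)"
      by (rule P.prob_space_distr) measurable
    fix A :: "'a set" assume A[measurable]: "A \<in> sets borel"
    have "emeasure (distr S borel Y) A = (\<integral>\<^sup>+ x. indicator A x \<partial>distr S borel Y)"
      by simp
    also have "\<dots> = (\<integral>\<^sup>+ \<omega>. indicator A (Y \<omega>) \<partial>S)"
      by (rule nn_integral_distr) measurable
    also have "\<dots> = (\<integral>\<^sup>+ i. \<integral>\<^sup>+ \<omega>. indicator A (Y (case_nat i \<omega>)) \<partial>S \<partial>\<mu>)"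
      by (rule nn_integral_case_nat) measurable
    also have "\<dots> = (\<integral>\<^sup>+ i. emeasure (distr (distr S borel Y) borel (apply_bcontfun (f i))) A \<partial>\<mu>)"
    proof (rule nn_integral_cong_AE)
      show "AE i in \<mu>. (\<integral>\<^sup>+ \<omega>. indicator A (Y (case_nat i \<omega>)) \<partial>S) =
          emeasure (distr (distr S borel Y) borel (apply_bcontfun (f i))) A"
        using Y_equivariant
      proof eventually_elim
        case (elim i)
        have "emeasure (distr (distr S borel Y) borel (apply_bcontfun (f i))) A =
            (\<integral>\<^sup>+ x. indicator A x \<partial>distr (distr S borel Y) borel (apply_bcontfun (f i)))"
          by simp
        also have "\<dots> = (\<integral>\<^sup>+ x. indicator A (f i x) \<partial>distr S borel Y)"
          by (rule nn_integral_distr) measurable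
        also have "\<dots> = (\<integral>\<^sup>+ \<omega>. indicator A (f i (Y \<omega>)) \<partial>S)"
          by (rule nn_integral_distr) measurable
        also have "\<dots> = (\<integral>\<^sup>+ \<omega>. indicator A (Y (case_nat i \<omega>)) \<partial>S)"
          by (rule nn_integral_cong_AE) (use elim in eventually_elim, simp)
        finally show ?case ..
      qed
    qed
    finally show "emeasure (distr S borel Y) A =
        (\<integral>\<^sup>+ i. emeasure (distr (distr S borel Y) borel (apply_bcontfun (f i))) A \<partial>\<mu>)" .
  qed simp
  then show ?thesis ..
qed

end

theorem proposition1p1:
  fixes I :: "'i set"
    and f :: "'i \<Rightarrow> 'a \<Rightarrow>\<^sub>C 'a::metric_space"
    and \<mu> :: "'i measure"
    and q :: real
  assumes "compact (UNIV :: 'a set)"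
    and "random_dynamical_system I f \<mu>"
    and "proximal I f"
    and "0 < q" and "q < 1"
    and "local_contraction f \<mu> q"
  shows "synchronizing f \<mu> \<and>
         (\<exists>!\<nu>. stationary f \<mu> \<nu>) \<and>
         (\<forall>x y. AE \<omega> in path_measure \<mu>. \<exists>C>0. \<forall>n\<ge>1.
            dist (iterate f \<omega> n x) (iterate f \<omega> n y) \<le> C * q ^ n)"
proof -
  interpret compact_random_system I f \<mu>
    using assms(1,2) by unfold_locales
  have "AE \<omega> in S. \<exists>C>0. \<forall>n\<ge>1. dist (iterate f \<omega> n x) (iterate f \<omega> n y) \<le> C * q ^ n" for x y
    using AE_exp_close[OF assms(3,6,4), of x y]
  proof eventually_elim
    case (elim \<omega>)
    then obtain m :: nat where m: "\<And>n. dist (iterate f \<omega> n x) (iterate f \<omega> n y) \<le> real m * q ^ n"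
      unfolding exp_close_def by blast
    \<comment> \<open>The constant \<open>m\<close> may be 0, whereas \<open>C\<close> has to be
      positive.\<close>
    have "real m * q ^ n \<le> real (Suc m) * q ^ n" for n
      using assms(4) by (intro mult_right_mono) simp_all
    then have "dist (iterate f \<omega> n x) (iterate f \<omega> n y) \<le> real (Suc m) * q ^ n" for n
      using m order_trans by blast
    then show ?case
      by (intro exI[of _ "real (Suc m)"]) simp
  qed
  moreover have "synchronizing f \<mu>"
    unfolding synchronizing_def using AE_dist_iterate_tendsto_0[OF assms(3,6,4,5)] by blast
  moreover have "\<exists>!\<nu>. stationary f \<mu> \<nu>"
    using stationary_exists[OF assms(3,6,4,5)] stationary_unique[OF assms(3,6,4,5)] by blast
  ultimately show ?thesis
    by blast
qed

end
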